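(* Let $K$ be a field of prime characteristic $p>3$ and let $n$ be a positive integer with $p\mid n$. The $p$-Kostka numbers $[M^{(n-3,2,1)}:Y^{(n-3,3)}]$ (for $n\ge 6$, so that $(n-3,3)$ is a partition) and $[M^{(n-3,2,1)}:Y^{(n-2,1^2)}]$ are positive. If $p=5$, then $[M^{(n-3,2,1)}:Y^{(n-2,2)}]$ is also positive.
   Context: $\mathfrak{S}_n$ is the symmetric group. For a partition $\lambda$ of $n$, the Young permutation module $M^\lambda$ is the permutation $K\mathfrak{S}_n$-module on the left cosets of the Young subgroup $\mathfrak{S}_\lambda=\mathfrak{S}_{\lambda_1}\times\mathfrak{S}_{\lambda_2}\times\cdots$. The Specht module $S^\lambda\le M^\lambda$ is the submodule spanned by the $\lambda$-polytabloids. The Young module $Y^\lambda$ is the indecomposable direct summand of $M^\lambda$ (unique up to isomorphism) containing $S^\lambda$ in some direct sum decomposition of $M^\lambda$ into indecomposables. Each $M^\lambda$ is isomorphic to a direct sum of Young modules $Y^\mu$ with $\mu$ dominating $\lambda$, with $Y^\lambda$ appearing exactly once, and non-isomorphic Young modules are labelled by different partitions. The $p$-Kostka number $[M^\lambda:Y^\mu]$ is the multiplicity of $Y^\mu$ in such a decomposition of $M^\lambda$. The notation $(n-2,1^2)$ means $(n-2,1,1)$. *)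

theory Defs
  imports
    "HOL-Algebra.Sym_Groups"
    "HOL-Algebra.Left_Coset"
    "HOL-Library.Function_Algebras"
    "HOL-Library.Indicator_Function"
    "HOL-Computational_Algebra.Primes"
begin

section \<open>Modules over a group algebra inside a coset function space\<close>

text \<open>
  Let \<open>G\<close> be a finite group and \<open>'k\<close> a field. All permutation modules on the left cosets of
  subgroups of \<open>G\<close> live in the single function space \<open>'g set \<Rightarrow> 'k\<close>, on which \<open>G\<close> acts through
  left translation of the argument; the basis vector of a coset \<open>C\<close> is \<open>indicator {C}\<close>.
  A module over the group algebra is represented as a vector subspace closed under this action.
\<close>

definition scale_fun :: "'k::field \<Rightarrow> ('x \<Rightarrow> 'k) \<Rightarrow> ('x \<Rightarrow> 'k)"
  where "scale_fun c f = (\<lambda>x. c * f x)"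

interpretation fun_space: vector_space scale_fun
  by unfold_locales (auto simp: scale_fun_def fun_eq_iff algebra_simps)

text \<open>With this action, \<open>g\<close> sends \<open>indicator {C}\<close> to \<open>indicator {g <#\<^bsub>G\<^esub> C}\<close>.\<close>

definition act :: "('g, 'b) monoid_scheme \<Rightarrow> 'g \<Rightarrow> ('g set \<Rightarrow> 'k) \<Rightarrow> ('g set \<Rightarrow> 'k)"
  where "act G g f = (\<lambda>C. f (inv\<^bsub>G\<^esub> g <#\<^bsub>G\<^esub> C))"

definition submodule :: "('g, 'b) monoid_scheme \<Rightarrow> ('g set \<Rightarrow> 'k::field) set \<Rightarrow> bool"
  where "submodule G W \<longleftrightarrow>
    fun_space.subspace W \<and> (\<forall>g\<in>carrier G. \<forall>f\<in>W. act G g f \<in> W)"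

definition permutation_module ::
    "('g, 'b) monoid_scheme \<Rightarrow> 'g set \<Rightarrow> ('g set \<Rightarrow> 'k::field) set"
  where "permutation_module G H = {f. \<forall>C. C \<notin> lcosets\<^bsub>G\<^esub> H \<longrightarrow> f C = 0}"

definition isomorphic ::
    "('g, 'b) monoid_scheme \<Rightarrow> ('g set \<Rightarrow> 'k::field) set \<Rightarrow> ('g set \<Rightarrow> 'k) set \<Rightarrow> bool"
  where "isomorphic G V W \<longleftrightarrow>
    (\<exists>\<phi>. bij_betw \<phi> V W \<and>
      (\<forall>x\<in>V. \<forall>y\<in>V. \<phi> (x + y) = \<phi> x + \<phi> y) \<and>
      (\<forall>c. \<forall>x\<in>V. \<phi> (scale_fun c x) = scale_fun c (\<phi> x)) \<and>
      (\<forall>g\<in>carrier G. \<forall>x\<in>V. \<phi> (act G g x) = act G g (\<phi> x)))"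

text \<open>Internal direct sums: every element of \<open>M\<close> is uniquely a sum of elements of the members
  of \<open>Ws\<close>, one from each.\<close>

definition direct_sum ::
    "('g, 'b) monoid_scheme \<Rightarrow> ('g set \<Rightarrow> 'k::field) set \<Rightarrow> ('g set \<Rightarrow> 'k) set list \<Rightarrow> bool"
  where "direct_sum G M Ws \<longleftrightarrow>
    (\<forall>W\<in>set Ws. submodule G W) \<and>
    bij_betw (\<lambda>v. \<Sum>i<length Ws. v i) (\<Pi>\<^sub>E i\<in>{..<length Ws}. Ws ! i) M"

definition indecomposable :: "('g, 'b) monoid_scheme \<Rightarrow> ('g set \<Rightarrow> 'k::field) set \<Rightarrow> bool"
  where "indecomposable G W \<longleftrightarrow>
    submodule G W \<and> W \<noteq> {0} \<and> (\<forall>A B. direct_sum G W [A, B] \<longrightarrow> A = {0} \<or> B = {0})"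

definition indecomposable_decomposition ::
    "('g, 'b) monoid_scheme \<Rightarrow> ('g set \<Rightarrow> 'k::field) set \<Rightarrow> ('g set \<Rightarrow> 'k) set list \<Rightarrow> bool"
  where "indecomposable_decomposition G M Ws \<longleftrightarrow>
    direct_sum G M Ws \<and> (\<forall>W\<in>set Ws. indecomposable G W)"

text \<open>For a submodule \<open>M\<close> of finite dimension the choice of the decomposition is immaterial, by
  the Krull--Schmidt theorem.\<close>

definition multiplicity_in ::
    "('g, 'b) monoid_scheme \<Rightarrow> ('g set \<Rightarrow> 'k::field) set \<Rightarrow> ('g set \<Rightarrow> 'k) set \<Rightarrow> nat"
  where "multiplicity_in G M Y =
    (SOME m. \<exists>Ws. indecomposable_decomposition G M Ws \<and>
                  m = length (filter (isomorphic G Y) Ws))"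


section \<open>Young permutation modules, Specht modules and Young modules\<close>

text \<open>
  A partition \<open>\<mu>\<close> of \<open>n\<close> is the weakly decreasing list of its parts. Rows and columns are
  numbered from \<open>0\<close>, and a \<open>\<mu>\<close>-tableau \<open>t\<close> has the entry \<open>t i j\<close> in row \<open>i\<close> and column \<open>j\<close>;
  the values of \<open>t\<close> outside the diagram are irrelevant.
\<close>

definition tableau_row :: "nat list \<Rightarrow> (nat \<Rightarrow> nat \<Rightarrow> nat) \<Rightarrow> nat \<Rightarrow> nat set"
  where "tableau_row \<mu> t i = {t i j | j. j < \<mu> ! i}"

definition tableau_column :: "nat list \<Rightarrow> (nat \<Rightarrow> nat \<Rightarrow> nat) \<Rightarrow> nat \<Rightarrow> nat set"
  where "tableau_column \<mu> t j = {t i j | i. i < length \<mu> \<and> j < \<mu> ! i}"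

text \<open>The tableau with the entries \<open>1, \<dots>, n\<close> written row by row.\<close>

definition initial_tableau :: "nat list \<Rightarrow> nat \<Rightarrow> nat \<Rightarrow> nat"
  where "initial_tableau \<mu> i j = sum_list (take i \<mu>) + Suc j"

definition young_subgroup :: "nat \<Rightarrow> nat list \<Rightarrow> (nat \<Rightarrow> nat) set"
  where "young_subgroup n \<mu> =
    {\<sigma> \<in> carrier (sym_group n). \<forall>i<length \<mu>.
       \<sigma> ` tableau_row \<mu> (initial_tableau \<mu>) i = tableau_row \<mu> (initial_tableau \<mu>) i}"

definition column_stabilizer ::
    "nat \<Rightarrow> nat list \<Rightarrow> (nat \<Rightarrow> nat \<Rightarrow> nat) \<Rightarrow> (nat \<Rightarrow> nat) set"
  where "column_stabilizer n \<mu> t =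
    {\<pi> \<in> carrier (sym_group n). \<forall>j. \<pi> ` tableau_column \<mu> t j = tableau_column \<mu> t j}"

definition young_permutation_module ::
    "nat \<Rightarrow> nat list \<Rightarrow> ((nat \<Rightarrow> nat) set \<Rightarrow> 'k::field) set"
  where "young_permutation_module n \<mu> = permutation_module (sym_group n) (young_subgroup n \<mu>)"

text \<open>
  Every \<open>\<mu>\<close>-tableau is \<open>t = \<sigma> \<circ> t\<^sub>0\<close> for a unique \<open>\<sigma>\<close> in the symmetric group, where \<open>t\<^sub>0\<close> is the
  initial tableau, and its tabloid \<open>{t}\<close> corresponds to the left coset of \<open>\<sigma>\<close> modulo the Young
  subgroup. The polytabloid of \<open>t\<close> is the sum of \<open>sign \<pi> \<cdot> \<pi>{t}\<close> over the column stabilizer of \<open>t\<close>.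
\<close>

definition polytabloid ::
    "nat \<Rightarrow> nat list \<Rightarrow> (nat \<Rightarrow> nat) \<Rightarrow> ((nat \<Rightarrow> nat) set \<Rightarrow> 'k::field)"
  where "polytabloid n \<mu> \<sigma> =
    (\<Sum>\<pi>\<in>column_stabilizer n \<mu> (\<lambda>i j. \<sigma> (initial_tableau \<mu> i j)).
       scale_fun (of_int (sign \<pi>))
         (indicator {(\<pi> \<circ> \<sigma>) <#\<^bsub>sym_group n\<^esub> young_subgroup n \<mu>}))"

definition specht_module :: "nat \<Rightarrow> nat list \<Rightarrow> ((nat \<Rightarrow> nat) set \<Rightarrow> 'k::field) set"
  where "specht_module n \<mu> = fun_space.span (polytabloid n \<mu> ` carrier (sym_group n))"

definition is_young_module ::
    "nat \<Rightarrow> nat list \<Rightarrow> ((nat \<Rightarrow> nat) set \<Rightarrow> 'k::field) set \<Rightarrow> bool"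
  where "is_young_module n \<mu> Y \<longleftrightarrow>
    (\<exists>Ws. indecomposable_decomposition (sym_group n) (young_permutation_module n \<mu>) Ws \<and>
          Y \<in> set Ws \<and> specht_module n \<mu> \<subseteq> Y)"

text \<open>The Young module is determined up to isomorphism only; \<open>young_module\<close> is a representative.\<close>

definition young_module :: "nat \<Rightarrow> nat list \<Rightarrow> ((nat \<Rightarrow> nat) set \<Rightarrow> 'k::field) set"
  where "young_module n \<mu> = (SOME Y. is_young_module n \<mu> Y)"

text \<open>The \<open>p\<close>-Kostka number \<open>[M\<^sup>\<nu> : Y\<^sup>\<mu>]\<close> over the field \<open>'k\<close>.\<close>

definition p_kostka :: "'k::field itself \<Rightarrow> nat \<Rightarrow> nat list \<Rightarrow> nat list \<Rightarrow> nat"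
  where "p_kostka _ n \<nu> \<mu> =
    multiplicity_in (sym_group n)
      (young_permutation_module n \<nu> :: ((nat \<Rightarrow> nat) set \<Rightarrow> 'k) set) (young_module n \<mu>)"

end

theory Submission
  imports Defs
begin

text \<open>
  If \<open>M\<^sup>\<mu>\<close> is isomorphic to a direct summand of \<open>M\<^sup>\<nu>\<close>, then so is its summand \<open>Y\<^sup>\<mu>\<close>, and since the
  endomorphism ring of an indecomposable module is local (Fitting), \<open>Y\<^sup>\<mu>\<close> occurs in every
  decomposition of \<open>M\<^sup>\<nu>\<close>. Write \<open>n = m + 3\<close> and \<open>\<nu> = (m, 2, 1)\<close>. For \<open>\<mu> = (m, 3)\<close> the Young subgroup
  of \<open>\<nu>\<close> has index 3 in that of \<open>\<mu>\<close>, which is invertible, so transfer splits the inclusion. For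
  \<open>\<mu> = (m + 1, 1, 1)\<close> the composite \<open>M\<^sup>\<mu> \<rightarrow> M\<^sup>\<nu> \<rightarrow> M\<^sup>\<mu>\<close> of the natural maps is \<open>m + T\<close> with
  \<open>T\<^sup>2 = (m + 2) T\<close>; its eigenvalues \<open>m = -3\<close> and \<open>2 m + 2 = -4\<close> are invertible. Finally,
  \<open>M\<close> of \<open>(m + 1, 2)\<close> is a summand of \<open>M\<close> of \<open>(m + 1, 1, 1)\<close> because of the index 2.
\<close>

text \<open>Both \<open>young_module\<close> and the multiplicity are chosen by \<open>SOME\<close>,
  so two choices have to be controlled. A Young module in the sense of the definition must be shown
  to exist, and positivity must hold for whichever decomposition the multiplicity refers to.
  Existence asks for an indecomposable summand containing the whole Specht module. As the
  polytabloids form a single orbit, it suffices to catch one of them; here 2 has to be invertible,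
  since a signed column sum equal to its own negative must vanish. The constants come from p
  dividing n = m + 3: in the field m = -3, and p > 3 makes 2, 3 and 4 invertible. The composite on M
  of (m + 1, 1, 1) is computable because its cosets are the ordered pairs (a, b) of distinct
  entries. T replaces a by the sum over all entries different from b, so applying it twice only
  counts these m + 2 entries once more.\<close>

text \<open>Resolution eta-expands terms of function type; the pointwise rules would then split the
  vectors of the function space into their values.\<close>

declare plus_fun_apply [simp del] zero_fun_apply [simp del] minus_apply [simp del]
  uminus_apply [simp del]

section \<open>Finite-dimensional subspaces of a function space\<close>

text \<open>The finite spanning set may lie outside \<open>V\<close>, so the property passes to
  every subset without a basis argument. The ambient function space itself need not be
  finite-dimensional.\<close>

definition finite_dim :: "('x \<Rightarrow> 'k::field) set \<Rightarrow> bool"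
  where "finite_dim V \<longleftrightarrow> (\<exists>T. finite T \<and> V \<subseteq> fun_space.span T)"

lemma finite_dim_mono: "finite_dim W \<Longrightarrow> V \<subseteq> W \<Longrightarrow> finite_dim V"
  unfolding finite_dim_def by blast

text \<open>A basis of \<open>V\<close> together with one vector of \<open>W\<close> outside
  \<open>V\<close> is independent and extends to a basis of \<open>W\<close>. That basis is finite
  because \<open>W\<close> lies in a finite span, so the cardinalities compare strictly.\<close>

lemma dim_strict_mono:
  assumes "finite_dim W" "fun_space.subspace V" "V \<subset> W"
  shows "fun_space.dim V < fun_space.dim W"
proof -
  obtain T where T: "finite T" "W \<subseteq> fun_space.span T"
    using assms(1) unfolding finite_dim_def by blast
  obtain B where B: "B \<subseteq> V" "fun_space.independent B" "V \<subseteq> fun_space.span B"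
      "card B = fun_space.dim V"
    using fun_space.basis_exists by blast
  have "fun_space.span B \<subseteq> V"
    using B(1) assms(2) fun_space.span_minimal by blast
  moreover obtain w where w: "w \<in> W" "w \<notin> V"
    using assms(3) by blast
  ultimately have "fun_space.independent (insert w B)"
    using B(2) fun_space.independent_insertI by blast
  moreover have "insert w B \<subseteq> W"
    using B(1) w assms(3) by blast
  ultimately obtain C where C: "insert w B \<subseteq> C" "C \<subseteq> W" "fun_space.independent C"
      "W \<subseteq> fun_space.span C"
    using fun_space.maximal_independent_subset_extend by metis
  have "finite C"
    using fun_space.independent_span_bound[OF T(1) C(3)] C(2) T(2) by blast
  moreover have "w \<notin> B"
    using w B(1) by blast
  ultimately have "card B < card C"
    using C(1) by (metis card_mono card_insert_disjoint finite_subset less_eq_Suc_le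
        finite_insert)
  moreover have "card C = fun_space.dim W"
    using C by (metis fun_space.dim_unique)
  ultimately show ?thesis
    using B(4) by simp
qed

text \<open>Otherwise the dimension would drop forever. One equality of neighbours is enough: for
  the images of the powers of a map it propagates to all higher powers.\<close>

lemma descending_chain:
  assumes "finite_dim (A 0)" "\<And>n. fun_space.subspace (A n)" "\<And>n. A (Suc n) \<subseteq> A n"
  shows "\<exists>n::nat. A (Suc n) = A n"
proof (rule ccontr)
  assume no: "\<nexists>n. A (Suc n) = A n"
  have sub: "A n \<subseteq> A 0" for n
    by (induction n) (use assms(3) in blast)+
  have "fun_space.dim (A n) + n \<le> fun_space.dim (A 0)" for n
  proof (induction n)
    case (Suc n)
    have "A (Suc n) \<subset> A n"
      using assms(3) no by blast
    then have "fun_space.dim (A (Suc n)) < fun_space.dim (A n)"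
      by (rule dim_strict_mono[rotated 2]) (use finite_dim_mono[OF assms(1) sub] assms(2) in blast)+
    then show ?case
      using Suc by simp
  qed simp
  from this[of "Suc (fun_space.dim (A 0))"] show False
    by simp
qed

lemma ascending_chain:
  assumes "finite_dim Y" "\<And>n. fun_space.subspace (A n)" "\<And>n. A n \<subseteq> A (Suc n)" "\<And>n. A n \<subseteq> Y"
  shows "\<exists>n::nat. A (Suc n) = A n"
proof (rule ccontr)
  assume no: "\<nexists>n. A (Suc n) = A n"
  have less: "fun_space.dim (A n) < fun_space.dim (A (Suc n))" for n
    by (rule dim_strict_mono) (use finite_dim_mono[OF assms(1,4)] assms no in blast)+
  have le: "n \<le> fun_space.dim (A n)" for n
    by (induction n) (use less in \<open>auto intro: Suc_leI order_le_less_trans\<close>)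
  have "fun_space.dim (A n) \<le> fun_space.dim Y" for n
    using dim_strict_mono[OF assms(1,2), of n] assms(4)[of n]
    by (cases "A n = Y") (simp_all add: psubset_eq)
  from order_trans[OF le this, of "Suc (fun_space.dim Y)"] show False
    by simp
qed

section \<open>Homomorphisms and direct sums\<close>

text \<open>The laws are required on \<open>V\<close> only. Maps built from \<open>inv_into\<close>
  or from direct sum projections are not controlled anywhere else.\<close>

definition mod_hom ::
    "('g, 'b) monoid_scheme \<Rightarrow> ('g set \<Rightarrow> 'k::field) set \<Rightarrow> ('g set \<Rightarrow> 'k) set \<Rightarrow>
      (('g set \<Rightarrow> 'k) \<Rightarrow> ('g set \<Rightarrow> 'k)) \<Rightarrow> bool"
  where "mod_hom G V W \<phi> \<longleftrightarrow>
    (\<forall>x\<in>V. \<phi> x \<in> W) \<and>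
    (\<forall>x\<in>V. \<forall>y\<in>V. \<phi> (x + y) = \<phi> x + \<phi> y) \<and>
    (\<forall>c. \<forall>x\<in>V. \<phi> (scale_fun c x) = scale_fun c (\<phi> x)) \<and>
    (\<forall>g\<in>carrier G. \<forall>x\<in>V. \<phi> (act G g x) = act G g (\<phi> x))"

lemma act_add: "act G g (x + y) = act G g x + act G g y"
  by (simp add: act_def plus_fun_def)

lemma act_scale: "act G g (scale_fun c x) = scale_fun c (act G g x)"
  by (auto simp: act_def scale_fun_def)

lemma act_zero [simp]: "act G g 0 = 0"
  by (simp add: act_def zero_fun_def)

lemma act_sum: "act G g (\<Sum>i\<in>I. f i) = (\<Sum>i\<in>I. act G g (f i))"
  by (induction I rule: infinite_finite_induct) (simp_all add: act_add)

lemma submodule_zero: "submodule G W \<Longrightarrow> 0 \<in> W"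
  and submodule_add: "submodule G W \<Longrightarrow> x \<in> W \<Longrightarrow> y \<in> W \<Longrightarrow> x + y \<in> W"
  and submodule_diff: "submodule G W \<Longrightarrow> x \<in> W \<Longrightarrow> y \<in> W \<Longrightarrow> x - y \<in> W"
  and submodule_scale: "submodule G W \<Longrightarrow> x \<in> W \<Longrightarrow> scale_fun c x \<in> W"
  and submodule_act: "submodule G W \<Longrightarrow> g \<in> carrier G \<Longrightarrow> x \<in> W \<Longrightarrow> act G g x \<in> W"
  and submodule_subspace: "submodule G W \<Longrightarrow> fun_space.subspace W"
  by (auto simp: submodule_def fun_space.subspace_def fun_space.subspace_diff)

lemma submodule_sum:
  "submodule G W \<Longrightarrow> (\<And>i. i \<in> I \<Longrightarrow> f i \<in> W) \<Longrightarrow> (\<Sum>i\<in>I. f i) \<in> W"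
  by (meson fun_space.subspace_sum submodule_subspace)

lemma submoduleI:
  assumes "0 \<in> W" "\<And>x y. x \<in> W \<Longrightarrow> y \<in> W \<Longrightarrow> x + y \<in> W"
    "\<And>c x. x \<in> W \<Longrightarrow> scale_fun c x \<in> W" "\<And>g x. g \<in> carrier G \<Longrightarrow> x \<in> W \<Longrightarrow> act G g x \<in> W"
  shows "submodule G W"
  using assms by (auto simp: submodule_def fun_space.subspace_def)

lemma mod_hom_in: "mod_hom G V W \<phi> \<Longrightarrow> x \<in> V \<Longrightarrow> \<phi> x \<in> W"
  and mod_hom_add: "mod_hom G V W \<phi> \<Longrightarrow> x \<in> V \<Longrightarrow> y \<in> V \<Longrightarrow> \<phi> (x + y) = \<phi> x + \<phi> y"
  and mod_hom_scale: "mod_hom G V W \<phi> \<Longrightarrow> x \<in> V \<Longrightarrow> \<phi> (scale_fun c x) = scale_fun c (\<phi> x)"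
  and mod_hom_act: "mod_hom G V W \<phi> \<Longrightarrow> g \<in> carrier G \<Longrightarrow> x \<in> V \<Longrightarrow> \<phi> (act G g x) = act G g (\<phi> x)"
  by (auto simp: mod_hom_def)

lemma mod_hom_zero: "mod_hom G V W \<phi> \<Longrightarrow> submodule G V \<Longrightarrow> \<phi> 0 = 0"
  using mod_hom_add[of G V W \<phi> 0 0] submodule_zero[of G V] by simp

lemma mod_hom_diff:
  assumes "mod_hom G V W \<phi>" "submodule G V" "x \<in> V" "y \<in> V"
  shows "\<phi> (x - y) = \<phi> x - \<phi> y"
  using mod_hom_add[OF assms(1) submodule_diff[OF assms(2-4)] assms(4)] by simp

lemma mod_hom_inj_onI:
  assumes "mod_hom G V W \<phi>" "submodule G V" "\<And>x. x \<in> V \<Longrightarrow> \<phi> x = 0 \<Longrightarrow> x = 0"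
  shows "inj_on \<phi> V"
proof (rule inj_onI)
  fix x y assume *: "x \<in> V" "y \<in> V" "\<phi> x = \<phi> y"
  have "x - y = 0"
    using * by (subst assms(3)[of "x - y"]) (simp_all add: mod_hom_diff[OF assms(1,2)] submodule_diff[OF assms(2)])
  then show "x = y"
    by simp
qed

lemma mod_hom_id: "V \<subseteq> W \<Longrightarrow> mod_hom G V W (\<lambda>x. x)"
  by (auto simp: mod_hom_def)

lemma mod_hom_comp:
  "mod_hom G U V \<phi> \<Longrightarrow> mod_hom G V W \<psi> \<Longrightarrow> mod_hom G U W (\<lambda>x. \<psi> (\<phi> x))"
  by (auto simp: mod_hom_def)

lemma mod_hom_subset:
  "mod_hom G V W \<phi> \<Longrightarrow> V' \<subseteq> V \<Longrightarrow> W \<subseteq> W' \<Longrightarrow> mod_hom G V' W' \<phi>"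
  by (auto simp: mod_hom_def subset_iff)

lemma mod_hom_plus:
  "mod_hom G V W \<phi> \<Longrightarrow> mod_hom G V W \<psi> \<Longrightarrow> submodule G W \<Longrightarrow> mod_hom G V W (\<lambda>x. \<phi> x + \<psi> x)"
  by (auto simp: mod_hom_def submodule_add act_add fun_space.scale_right_distrib ac_simps)

lemma mod_hom_const_zero: "submodule G W \<Longrightarrow> mod_hom G V W (\<lambda>x. 0)"
  by (auto simp: mod_hom_def submodule_zero)

lemma mod_hom_sum:
  assumes "submodule G W" "\<And>i. i \<in> I \<Longrightarrow> mod_hom G V W (h i)"
  shows "mod_hom G V W (\<lambda>x. \<Sum>i\<in>I. h i x)"
  using assms(2)
  by (induction I rule: infinite_finite_induct)
    (auto intro: mod_hom_plus mod_hom_const_zero assms(1))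

lemma mod_hom_scaled:
  "mod_hom G V W \<phi> \<Longrightarrow> submodule G W \<Longrightarrow> mod_hom G V W (\<lambda>x. scale_fun c (\<phi> x))"
  by (auto simp: mod_hom_def submodule_scale act_scale fun_space.scale_right_distrib ac_simps)

lemma mod_hom_funpow: "mod_hom G V V \<phi> \<Longrightarrow> mod_hom G V V (\<phi> ^^ n)"
  by (induction n) (auto simp: mod_hom_def)

lemma submodule_image:
  assumes "mod_hom G V W \<phi>" "submodule G V"
  shows "submodule G (\<phi> ` V)"
proof (rule submoduleI)
  show "0 \<in> \<phi> ` V"
    using mod_hom_zero[OF assms] submodule_zero[OF assms(2)] by (metis image_eqI)
qed (use assms in \<open>auto simp: mod_hom_add[OF assms(1), symmetric]
      mod_hom_scale[OF assms(1), symmetric] mod_hom_act[OF assms(1), symmetric]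
      submodule_add submodule_scale submodule_act\<close>)

lemma submodule_kernel:
  assumes "mod_hom G V W \<phi>" "submodule G V"
  shows "submodule G {x \<in> V. \<phi> x = 0}"
  by (rule submoduleI) (use assms in \<open>simp_all add: mod_hom_zero mod_hom_add mod_hom_scale mod_hom_act
      submodule_zero submodule_add submodule_scale submodule_act\<close>)

lemma mod_hom_inv_into:
  assumes "mod_hom G V W \<phi>" "bij_betw \<phi> V W" "submodule G V"
  shows "mod_hom G W V (inv_into V \<phi>)"
proof -
  let ?i = "inv_into V \<phi>"
  have i: "?i y \<in> V" "\<phi> (?i y) = y" if "y \<in> W" for y
    using assms(2) that by (auto simp: bij_betw_def inv_into_into f_inv_into_f)
  have eq: "?i (\<phi> x) = x" if "x \<in> V" for x
    using assms(2) that by (simp add: bij_betw_def)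
  have "?i (x + y) = ?i x + ?i y" if "x \<in> W" "y \<in> W" for x y
    using eq[OF submodule_add[OF assms(3) i(1)[OF that(1)] i(1)[OF that(2)]]] i that
    by (simp add: mod_hom_add[OF assms(1)])
  moreover have "?i (scale_fun c x) = scale_fun c (?i x)" if "x \<in> W" for x c
    using eq[OF submodule_scale[OF assms(3) i(1)[OF that]]] i that
    by (simp add: mod_hom_scale[OF assms(1)])
  moreover have "?i (act G g x) = act G g (?i x)" if "x \<in> W" "g \<in> carrier G" for x g
    using eq[OF submodule_act[OF assms(3) that(2) i(1)[OF that(1)]]] i that
    by (simp add: mod_hom_act[OF assms(1)])
  ultimately show ?thesis
    using i by (auto simp: mod_hom_def)
qed

section \<open>Internal direct sums, their projections and their refinement\<close>

lemma direct_sum_nthD: "direct_sum G M Ws \<Longrightarrow> i < length Ws \<Longrightarrow> submodule G (Ws ! i)"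
  by (simp add: direct_sum_def)

text \<open>The definition speaks of extensional families. Applying \<open>restrict\<close> does not
  change the sum, which carries existence here and uniqueness below over to arbitrary
  families.\<close>

lemma direct_sum_sum_in:
  assumes "direct_sum G M Ws" "\<And>i. i < length Ws \<Longrightarrow> v i \<in> Ws ! i"
  shows "(\<Sum>i<length Ws. v i) \<in> M"
proof -
  have "restrict v {..<length Ws} \<in> (\<Pi>\<^sub>E i\<in>{..<length Ws}. Ws ! i)"
    using assms(2) by auto
  then have "(\<Sum>i<length Ws. restrict v {..<length Ws} i) \<in> M"
    using assms(1) unfolding direct_sum_def bij_betw_def by blast
  then show ?thesis
    by simp
qed

lemma direct_sum_unique:
  assumes "direct_sum G M Ws" "\<And>i. i < length Ws \<Longrightarrow> v i \<in> Ws ! i"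
    "\<And>i. i < length Ws \<Longrightarrow> w i \<in> Ws ! i" "(\<Sum>i<length Ws. v i) = (\<Sum>i<length Ws. w i)"
    "i < length Ws"
  shows "v i = w i"
proof -
  have "restrict v {..<length Ws} = restrict w {..<length Ws}"
    by (rule inj_onD[of "\<lambda>v. \<Sum>i<length Ws. v i" "\<Pi>\<^sub>E i\<in>{..<length Ws}. Ws ! i"])
      (use assms in \<open>auto simp: direct_sum_def bij_betw_def\<close>)
  then show ?thesis
    using assms(5) by (metis lessThan_iff restrict_apply')
qed

lemma direct_sum_component:
  assumes "direct_sum G M Ws" "i < length Ws" "w \<in> Ws ! i"
  shows "w \<in> M"
proof -
  have "(\<Sum>j<length Ws. if j = i then w else 0) \<in> M"
    by (rule direct_sum_sum_in[OF assms(1)])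
      (auto simp: assms(3) submodule_zero[OF direct_sum_nthD[OF assms(1)]])
  then show ?thesis
    using assms(2) by simp
qed

lemma direct_sum_submodule:
  assumes "direct_sum G M Ws"
  shows "submodule G M"
proof -
  have M: "\<exists>v. (\<forall>i<length Ws. v i \<in> Ws ! i) \<and> x = (\<Sum>i<length Ws. v i)" if "x \<in> M" for x
  proof -
    have "x \<in> (\<lambda>v. \<Sum>i<length Ws. v i) ` (\<Pi>\<^sub>E i\<in>{..<length Ws}. Ws ! i)"
      using assms that unfolding direct_sum_def bij_betw_def by blast
    then show ?thesis
      by (auto simp: PiE_def Pi_def)
  qed
  show ?thesis
  proof (rule submoduleI)
    show "0 \<in> M"
      using direct_sum_sum_in[OF assms, of "\<lambda>_. 0"] direct_sum_nthD[OF assms] submodule_zero by auto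
  next
    fix x y assume "x \<in> M" "y \<in> M"
    then obtain v w where "\<forall>i<length Ws. v i \<in> Ws ! i" "x = (\<Sum>i<length Ws. v i)"
        "\<forall>i<length Ws. w i \<in> Ws ! i" "y = (\<Sum>i<length Ws. w i)"
      using M by metis
    then show "x + y \<in> M"
      using direct_sum_sum_in[OF assms, of "\<lambda>i. v i + w i"]
        submodule_add[OF direct_sum_nthD[OF assms]] by (simp add: sum.distrib)
  next
    fix c x assume "x \<in> M"
    then obtain v where "\<forall>i<length Ws. v i \<in> Ws ! i" "x = (\<Sum>i<length Ws. v i)"
      using M by metis
    then show "scale_fun c x \<in> M"
      using direct_sum_sum_in[OF assms, of "\<lambda>i. scale_fun c (v i)"]
        submodule_scale[OF direct_sum_nthD[OF assms]] by (simp add: fun_space.scale_sum_right)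
  next
    fix g x assume "g \<in> carrier G" "x \<in> M"
    then obtain v where "\<forall>i<length Ws. v i \<in> Ws ! i" "x = (\<Sum>i<length Ws. v i)"
      using M by metis
    then show "act G g x \<in> M"
      using direct_sum_sum_in[OF assms, of "\<lambda>i. act G g (v i)"]
        submodule_act[OF direct_sum_nthD[OF assms]] \<open>g \<in> carrier G\<close> by (simp add: act_sum)
  qed
qed

text \<open>The projections invert the summation map. They are linear and equivariant because
  adding, scaling or translating the components of a vector gives valid components of the image
  vector, and components are unique.\<close>

lemma direct_sum_projections:
  assumes "direct_sum G M Ws"
  obtains P where "\<And>i. i < length Ws \<Longrightarrow> mod_hom G M (Ws ! i) (P i)"
    and "\<And>x. x \<in> M \<Longrightarrow> (\<Sum>i<length Ws. P i x) = x"
    and "\<And>v j. \<lbrakk>\<And>i. i < length Ws \<Longrightarrow> v i \<in> Ws ! i; j < length Ws\<rbrakk> \<Longrightarrow> P j (\<Sum>i<length Ws. v i) = v j"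
proof -
  let ?n = "length Ws"
  define P where "P i x = inv_into (\<Pi>\<^sub>E i\<in>{..<?n}. Ws ! i) (\<lambda>v. \<Sum>i<?n. v i) x i" for i x
  have im: "(\<lambda>v. \<Sum>i<?n. v i) ` (\<Pi>\<^sub>E i\<in>{..<?n}. Ws ! i) = M"
    using assms by (simp add: direct_sum_def bij_betw_def)
  have sumP: "(\<Sum>i<?n. P i x) = x" if "x \<in> M" for x
    unfolding P_def using f_inv_into_f[of x "\<lambda>v. \<Sum>i<?n. v i"] that im by blast
  have inP: "P i x \<in> Ws ! i" if "x \<in> M" "i < ?n" for x i
    unfolding P_def using inv_into_into[of x "\<lambda>v. \<Sum>i<?n. v i" "\<Pi>\<^sub>E i\<in>{..<?n}. Ws ! i"] that im
    by (auto simp: PiE_def Pi_def)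
  have uniq: "P j (\<Sum>i<?n. v i) = v j" if "\<And>i. i < ?n \<Longrightarrow> v i \<in> Ws ! i" "j < ?n" for v j
  proof (rule direct_sum_unique[OF assms, where v = "\<lambda>i. P i (\<Sum>i<?n. v i)"])
    have "(\<Sum>i<?n. v i) \<in> M"
      using direct_sum_sum_in[OF assms] that by blast
    then show "(\<Sum>i<?n. P i (\<Sum>i<?n. v i)) = (\<Sum>i<?n. v i)"
        "i < ?n \<Longrightarrow> P i (\<Sum>i<?n. v i) \<in> Ws ! i" for i
      using sumP inP by blast+
  qed (use that in auto)
  have sub: "submodule G (Ws ! i)" if "i < ?n" for i
    using assms that by (simp add: direct_sum_def)
  have "P j (x + y) = P j x + P j y" if "x \<in> M" "y \<in> M" "j < ?n" for x y j
    using uniq[of "\<lambda>i. P i x + P i y" j] that inP submodule_add[OF sub]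
    by (simp add: sum.distrib sumP)
  moreover have "P j (scale_fun c x) = scale_fun c (P j x)" if "x \<in> M" "j < ?n" for x j c
    using uniq[of "\<lambda>i. scale_fun c (P i x)" j] that inP submodule_scale[OF sub]
    by (simp add: fun_space.scale_sum_right[symmetric] sumP)
  moreover have "P j (act G g x) = act G g (P j x)" if "g \<in> carrier G" "x \<in> M" "j < ?n" for g x j
    using uniq[of "\<lambda>i. act G g (P i x)" j] that inP submodule_act[OF sub]
    by (simp add: act_sum[symmetric] sumP)
  ultimately show ?thesis
    using inP by (intro that[OF _ sumP uniq]) (auto simp: mod_hom_def)
qed

text \<open>Converse of the projections: \<open>P\<close> only has to be a two-sided inverse of the
  summation map as a function. It may come from plain choice, with no linearity to check.\<close>

lemma direct_sumI:
  assumes "\<And>i. i < length Ws \<Longrightarrow> submodule G (Ws ! i)"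
    and "\<And>i x. i < length Ws \<Longrightarrow> x \<in> M \<Longrightarrow> P i x \<in> Ws ! i"
    and "\<And>x. x \<in> M \<Longrightarrow> (\<Sum>i<length Ws. P i x) = x"
    and "\<And>v. (\<And>i. i < length Ws \<Longrightarrow> v i \<in> Ws ! i) \<Longrightarrow> (\<Sum>i<length Ws. v i) \<in> M"
    and "\<And>v j. \<lbrakk>\<And>i. i < length Ws \<Longrightarrow> v i \<in> Ws ! i; j < length Ws\<rbrakk> \<Longrightarrow> P j (\<Sum>i<length Ws. v i) = v j"
  shows "direct_sum G M Ws"
  unfolding direct_sum_def
proof (intro conjI)
  show "\<forall>W\<in>set Ws. submodule G W"
    using assms(1) by (auto simp: in_set_conv_nth)
  show "bij_betw (\<lambda>v. \<Sum>i<length Ws. v i) (\<Pi>\<^sub>E i\<in>{..<length Ws}. Ws ! i) M"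
  proof (rule bij_betw_byWitness[where f' = "\<lambda>x. restrict (\<lambda>i. P i x) {..<length Ws}"])
    show "\<forall>v\<in>\<Pi>\<^sub>E i\<in>{..<length Ws}. Ws ! i.
        restrict (\<lambda>i. P i (\<Sum>i<length Ws. v i)) {..<length Ws} = v"
    proof
      fix v assume v: "v \<in> (\<Pi>\<^sub>E i\<in>{..<length Ws}. Ws ! i)"
      show "restrict (\<lambda>i. P i (\<Sum>i<length Ws. v i)) {..<length Ws} = v"
      proof
        fix j
        show "restrict (\<lambda>i. P i (\<Sum>i<length Ws. v i)) {..<length Ws} j = v j"
          using assms(5)[of v j] v by (cases "j < length Ws") (auto simp: PiE_def Pi_def extensional_def)
      qed
    qed
  qed (use assms in \<open>auto simp: PiE_def Pi_def\<close>)
qed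

lemma direct_sum_pairI:
  assumes "submodule G A" "submodule G B" "A \<inter> B \<subseteq> {0}"
    and "M = {a + b | a b. a \<in> A \<and> b \<in> B}"
  shows "direct_sum G M [A, B]"
proof -
  have "\<forall>x\<in>M. \<exists>a b. a \<in> A \<and> b \<in> B \<and> x = a + b"
    using assms(4) by blast
  then obtain p q where pq: "\<And>x. x \<in> M \<Longrightarrow> p x \<in> A" "\<And>x. x \<in> M \<Longrightarrow> q x \<in> B"
      "\<And>x. x \<in> M \<Longrightarrow> p x + q x = x"
    by metis
  have uniq: "a = a' \<and> b = b'" if "a \<in> A" "a' \<in> A" "b \<in> B" "b' \<in> B" "a + b = a' + b'" for a a' b b'
  proof -
    have "a - a' = b' - b"
      using that(5) by (metis add_diff_cancel_left' add_diff_cancel_right' add_diff_eq diff_diff_eq2)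
    then have "a - a' \<in> A \<inter> B" "b' - b = a - a'"
      using submodule_diff assms(1,2) that by (metis IntI)+
    then show ?thesis
      using assms(3) by auto
  qed
  show ?thesis
  proof (rule direct_sumI[where P = "\<lambda>i. if i = 0 then p else q"])
    fix v j
    assume v: "\<And>i. i < length [A, B] \<Longrightarrow> v i \<in> [A, B] ! i" and j: "j < length [A, B]"
    then have v: "v 0 \<in> A" "v (Suc 0) \<in> B"
      using v[of 0] v[of 1] by auto
    then have "v 0 + v (Suc 0) \<in> M"
      using assms(4) by blast
    with uniq[of "p (v 0 + v (Suc 0))" "v 0" "q (v 0 + v (Suc 0))" "v (Suc 0)"] v pq j
    show "(if j = 0 then p else q) (\<Sum>i<length [A, B]. v i) = v j"
      by (auto simp: less_Suc_eq numeral_2_eq_2)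
  next
    fix v
    assume v: "\<And>i. i < length [A, B] \<Longrightarrow> v i \<in> [A, B] ! i"
    then show "(\<Sum>i<length [A, B]. v i) \<in> M"
      using v[of 0] v[of 1] assms(4) by auto
  qed (use assms(1,2) pq in \<open>auto simp: less_Suc_eq numeral_2_eq_2\<close>)
qed

lemma direct_sum_pairD:
  assumes "direct_sum G M [A, B]"
  shows "submodule G A" "submodule G B" "M = {a + b | a b. a \<in> A \<and> b \<in> B}" "A \<inter> B \<subseteq> {0}"
proof -
  show sA: "submodule G A" and sB: "submodule G B"
    using assms by (auto simp: direct_sum_def)
  obtain P where P: "\<And>i. i < length [A, B] \<Longrightarrow> mod_hom G M ([A, B] ! i) (P i)"
    and s: "\<And>x. x \<in> M \<Longrightarrow> (\<Sum>i<length [A, B]. P i x) = x"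
    using direct_sum_projections[OF assms] by metis
  show "M = {a + b | a b. a \<in> A \<and> b \<in> B}"
  proof (intro equalityI subsetI)
    fix x assume x: "x \<in> M"
    have "P 0 x \<in> A" "P 1 x \<in> B" "P 0 x + P 1 x = x"
      using s[OF x] mod_hom_in[OF P[of 0] x] mod_hom_in[OF P[of 1] x] by simp_all
    then show "x \<in> {a + b | a b. a \<in> A \<and> b \<in> B}"
      by (metis (mono_tags, lifting) mem_Collect_eq)
  next
    fix x assume "x \<in> {a + b | a b. a \<in> A \<and> b \<in> B}"
    then obtain a b where "a \<in> A" "b \<in> B" "x = a + b"
      by blast
    then show "x \<in> M"
      using direct_sum_sum_in[OF assms, of "\<lambda>i. if i = 0 then a else b"]
      by (force simp: less_Suc_eq numeral_2_eq_2)
  qed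
  show "A \<inter> B \<subseteq> {0}"
  proof
    fix x assume "x \<in> A \<inter> B"
    then have "(if (0::nat) = 0 then x else 0) = (if (0::nat) = 0 then 0 else x)"
      by (intro direct_sum_unique[OF assms, where v = "\<lambda>i. if i = 0 then x else 0"
            and w = "\<lambda>i. if i = 0 then 0 else x"])
        (auto simp: less_Suc_eq submodule_zero[OF sA] submodule_zero[OF sB])
    then show "x \<in> {0}"
      by simp
  qed
qed

lemma direct_sum_single: "submodule G M \<Longrightarrow> direct_sum G M [M]"
  by (rule direct_sumI[where P = "\<lambda>_ x. x"]) auto

lemma direct_sum_empty: "direct_sum G {0} []"
  by (rule direct_sumI[where P = "\<lambda>_ x. x"]) auto

text \<open>Refines a sum of two modules. The new projections are those of the parts composed with
  the two outer ones, with the indices of \<open>Bs\<close> shifted by the length of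
  \<open>As\<close>.\<close>

lemma direct_sum_append:
  assumes M: "direct_sum G M [A, B]" and A: "direct_sum G A As" and B: "direct_sum G B Bs"
  shows "direct_sum G M (As @ Bs)"
proof -
  let ?n = "length As"
  obtain P where P: "\<And>i. i < ?n \<Longrightarrow> mod_hom G A (As ! i) (P i)"
      "\<And>x. x \<in> A \<Longrightarrow> (\<Sum>i<?n. P i x) = x"
      "\<And>v j. \<lbrakk>\<And>i. i < ?n \<Longrightarrow> v i \<in> As ! i; j < ?n\<rbrakk> \<Longrightarrow> P j (\<Sum>i<?n. v i) = v j"
    using direct_sum_projections[OF A] by metis
  obtain Q where Q: "\<And>i. i < length Bs \<Longrightarrow> mod_hom G B (Bs ! i) (Q i)"
      "\<And>x. x \<in> B \<Longrightarrow> (\<Sum>i<length Bs. Q i x) = x"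
      "\<And>v j. \<lbrakk>\<And>i. i < length Bs \<Longrightarrow> v i \<in> Bs ! i; j < length Bs\<rbrakk> \<Longrightarrow> Q j (\<Sum>i<length Bs. v i) = v j"
    using direct_sum_projections[OF B] by metis
  obtain R where R: "\<And>i. i < length [A, B] \<Longrightarrow> mod_hom G M ([A, B] ! i) (R i)"
      "\<And>x. x \<in> M \<Longrightarrow> (\<Sum>i<length [A, B]. R i x) = x"
      "\<And>v j. \<lbrakk>\<And>i. i < length [A, B] \<Longrightarrow> v i \<in> [A, B] ! i; j < length [A, B]\<rbrakk>
        \<Longrightarrow> R j (\<Sum>i<length [A, B]. v i) = v j"
    using direct_sum_projections[OF M] by metis
  have R0: "R 0 x \<in> A" and R1: "R 1 x \<in> B" and R01: "R 0 x + R 1 x = x" if "x \<in> M" for x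
    using mod_hom_in[OF R(1)[of 0] that] mod_hom_in[OF R(1)[of 1] that] R(2)[OF that] by simp_all
  have Rab: "R 0 (a + b) = a" "R 1 (a + b) = b" if "a \<in> A" "b \<in> B" for a b
  proof -
    have "(if i = 0 then a else b) \<in> [A, B] ! i" if "i < length [A, B]" for i
      using that \<open>a \<in> A\<close> \<open>b \<in> B\<close> by (auto simp: less_Suc_eq numeral_2_eq_2)
    from R(3)[OF this, of 0] R(3)[OF this, of 1] show "R 0 (a + b) = a" "R 1 (a + b) = b"
      by simp_all
  qed
  have "(\<Sum>i<?n + m. v i) = (\<Sum>i<?n. v i) + (\<Sum>i<m. v (?n + i))"
    for m and v :: "nat \<Rightarrow> 'a set \<Rightarrow> 'c"
    by (induction m) (simp_all add: add.assoc)
  then have split: "(\<Sum>i<length (As @ Bs). v i) = (\<Sum>i<?n. v i) + (\<Sum>i<length Bs. v (?n + i))"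
    for v :: "nat \<Rightarrow> 'a set \<Rightarrow> 'c"
    by simp
  have parts: "(\<Sum>i<?n. v i) \<in> A" "(\<Sum>i<length Bs. v (?n + i)) \<in> B"
    if v: "\<And>i. i < length (As @ Bs) \<Longrightarrow> v i \<in> (As @ Bs) ! i" for v
  proof -
    have "v i \<in> As ! i" if "i < ?n" for i
      using v[of i] that by (simp add: nth_append)
    then show "(\<Sum>i<?n. v i) \<in> A"
      by (rule direct_sum_sum_in[OF A])
    have "v (?n + i) \<in> Bs ! i" if "i < length Bs" for i
      using v[of "?n + i"] that by (simp add: nth_append)
    then show "(\<Sum>i<length Bs. v (?n + i)) \<in> B"
      by (rule direct_sum_sum_in[OF B])
  qed
  show ?thesis
  proof (rule direct_sumI[where P = "\<lambda>i x. if i < ?n then P i (R 0 x) else Q (i - ?n) (R 1 x)"])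
    fix i assume "i < length (As @ Bs)"
    then show "submodule G ((As @ Bs) ! i)"
      using A B by (metis direct_sum_def Un_iff nth_mem set_append)
  next
    fix i x assume "i < length (As @ Bs)" "x \<in> M"
    then show "(if i < ?n then P i (R 0 x) else Q (i - ?n) (R 1 x)) \<in> (As @ Bs) ! i"
      using mod_hom_in[OF P(1) R0] mod_hom_in[OF Q(1) R1] by (auto simp: nth_append)
  next
    fix x assume "x \<in> M"
    then show "(\<Sum>i<length (As @ Bs). if i < ?n then P i (R 0 x) else Q (i - ?n) (R 1 x)) = x"
      unfolding split by (simp add: P(2)[OF R0] Q(2)[OF R1, simplified] R01[simplified])
  next
    fix v assume "\<And>i. i < length (As @ Bs) \<Longrightarrow> v i \<in> (As @ Bs) ! i"
    then show "(\<Sum>i<length (As @ Bs). v i) \<in> M"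
      unfolding split using parts[of v] direct_sum_pairD(3)[OF M] by blast
  next
    fix v j assume v: "\<And>i. i < length (As @ Bs) \<Longrightarrow> v i \<in> (As @ Bs) ! i" and j: "j < length (As @ Bs)"
    have "P j (\<Sum>i<?n. v i) = v j" if "j < ?n"
      using v by (intro P(3) that) (metis length_append nth_append trans_less_add1)
    moreover have "Q (j - ?n) (\<Sum>i<length Bs. v (?n + i)) = v (?n + (j - ?n))" if "\<not> j < ?n"
    proof (rule Q(3))
      show "v (?n + i) \<in> Bs ! i" if "i < length Bs" for i
        using v[of "?n + i"] that by (simp add: nth_append)
    qed (use j that in simp)
    ultimately show "(if j < ?n then P j (R 0 (\<Sum>i<length (As @ Bs). v i))
        else Q (j - ?n) (R 1 (\<Sum>i<length (As @ Bs). v i))) = v j"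
      unfolding split using Rab[OF parts[of v, OF v]] by simp
  qed
qed

text \<open>Induction on the dimension: both parts of a nontrivial splitting are proper subspaces,
  and their decompositions are concatenated.\<close>

lemma indecomposable_decomposition_exists:
  assumes "finite_dim M" "submodule G M"
  shows "\<exists>Ws. indecomposable_decomposition G M Ws"
  using assms
proof (induction "fun_space.dim M" arbitrary: M rule: less_induct)
  case less
  show ?case
  proof (cases "M = {0} \<or> indecomposable G M")
    \<comment> \<open>The zero module does not count as indecomposable; it is the sum of the empty
      list.\<close>
    case True
    then show ?thesis
      using direct_sum_empty[of G] direct_sum_single[of G M] less.prems
      by (metis (mono_tags, lifting) indecomposable_decomposition_def empty_iff list.set
          insert_iff)
  next
    case False
    then obtain A B where AB: "direct_sum G M [A, B]" "A \<noteq> {0}" "B \<noteq> {0}"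
      using less.prems(2) unfolding indecomposable_def by blast
    note D = direct_sum_pairD[OF AB(1)]
    have 0: "0 \<in> A" "0 \<in> B"
      using D(1,2) submodule_zero by blast+
    have sub: "A \<subseteq> M" "B \<subseteq> M"
    proof -
      have "a + 0 \<in> M" if "a \<in> A" for a
        using that 0 unfolding D(3) by blast
      moreover have "0 + b \<in> M" if "b \<in> B" for b
        using that 0 unfolding D(3) by blast
      ultimately show "A \<subseteq> M" "B \<subseteq> M"
        by auto
    qed
    \<comment> \<open>A part equal to \<open>M\<close> would contain the other one, which would then
      lie in the zero intersection.\<close>
    moreover have "\<not> B \<subseteq> A" "\<not> A \<subseteq> B"
      using 0 D(4) AB(2,3) by blast+
    ultimately have "A \<subset> M" "B \<subset> M"
      by blast+
    then have "\<exists>As. indecomposable_decomposition G A As" "\<exists>Bs. indecomposable_decomposition G B Bs"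
      using less.hyps[OF dim_strict_mono[OF less.prems(1) submodule_subspace[OF D(1)]]]
        less.hyps[OF dim_strict_mono[OF less.prems(1) submodule_subspace[OF D(2)]]]
        finite_dim_mono[OF less.prems(1)] D(1,2) sub by metis+
    then obtain As Bs where "indecomposable_decomposition G A As" "indecomposable_decomposition G B Bs"
      by blast
    then have "indecomposable_decomposition G M (As @ Bs)"
      using direct_sum_append[OF AB(1)] unfolding indecomposable_decomposition_def
      by (metis Un_iff set_append)
    then show ?thesis
      by blast
  qed
qed

section \<open>Fitting's lemma and the exchange property\<close>

lemma funpow_image_fixed:
  assumes "f ` A = A"
  shows "(f ^^ n) ` A = A"
proof (induction n)
  case (Suc n)
  have "(f ^^ Suc n) ` A = f ` (f ^^ n) ` A"
    by (simp add: image_image)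
  then show ?case
    using Suc assms by simp
qed simp

text \<open>The kernels of the powers ascend, so two consecutive ones agree, say for n and n + 1. By
  surjectivity a kernel vector x is the n-th image of some z; then z is killed by the power n + 1,
  hence already by the power n, and x is zero.\<close>

lemma surj_imp_inj:
  assumes f: "mod_hom G Y Y f" and Y: "submodule G Y" "finite_dim Y" and "f ` Y = Y"
  shows "inj_on f Y"
proof (rule mod_hom_inj_onI[OF f Y(1)])
  fix x assume x: "x \<in> Y" "f x = 0"
  let ?K = "\<lambda>n. {x \<in> Y. (f ^^ n) x = 0}"
  have sub: "fun_space.subspace (?K n)" for n
    by (rule submodule_subspace[OF submodule_kernel[OF mod_hom_funpow[OF f] Y(1)]])
  have "\<exists>n. ?K (Suc n) = ?K n"
    by (rule ascending_chain[OF Y(2) sub]) (auto simp: mod_hom_zero[OF f Y(1)])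
  then obtain n where n: "?K (Suc n) = ?K n"
    by blast
  have "(f ^^ n) ` Y = Y"
    by (rule funpow_image_fixed[OF assms(4)])
  then obtain z where z: "z \<in> Y" "x = (f ^^ n) z"
    using x(1) by blast
  then have "z \<in> ?K (Suc n)"
    using x(2) by simp
  then show "x = 0"
    using n z(2) by blast
qed

lemma image_chain:
  assumes f: "mod_hom G Y Y f" and Y: "submodule G Y" "finite_dim Y"
  shows "\<exists>n. f ` (f ^^ n) ` Y = (f ^^ n) ` Y"
proof -
  have sub: "fun_space.subspace ((f ^^ n) ` Y)" for n
    by (rule submodule_subspace[OF submodule_image[OF mod_hom_funpow[OF f] Y(1)]])
  have "(f ^^ Suc n) ` Y \<subseteq> (f ^^ n) ` Y" for n
    using mod_hom_in[OF f] unfolding funpow_Suc_right image_comp[symmetric] by blast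
  then have "\<exists>n. (f ^^ Suc n) ` Y = (f ^^ n) ` Y"
    using descending_chain[where A = "\<lambda>n. (f ^^ n) ` Y"] sub Y(2) by simp
  then show ?thesis
    by (simp add: image_comp)
qed

lemma inj_imp_surj:
  assumes f: "mod_hom G Y Y f" and Y: "submodule G Y" "finite_dim Y" and inj: "inj_on f Y"
  shows "f ` Y = Y"
proof -
  obtain n where n: "f ` (f ^^ n) ` Y = (f ^^ n) ` Y"
    using image_chain[OF f Y] by blast
  have injn: "inj_on (f ^^ n) Y"
  proof (induction n)
    case (Suc n)
    then show ?case
      using inj mod_hom_in[OF mod_hom_funpow[OF f]]
      by (auto simp: inj_on_def)
  qed simp
  have "(f ^^ n) ` f ` Y = (f ^^ n) ` Y"
    using n by (simp add: image_comp funpow_swap1 comp_def)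
  then show ?thesis
    using injn mod_hom_in[OF f] by (subst (asm) inj_on_image_eq_iff) auto
qed

text \<open>For n where the images of the powers stall, \<open>Y\<close> is the direct sum of the
  image and the kernel of the n-th power. Indecomposability kills one of them: a zero image means
  nilpotent, a zero kernel means bijective.\<close>

lemma fitting:
  assumes Y: "indecomposable G Y" "finite_dim Y" and f: "mod_hom G Y Y f"
  shows "bij_betw f Y Y \<or> (\<exists>n. \<forall>x\<in>Y. (f ^^ n) x = 0)"
proof -
  have sY: "submodule G Y"
    using Y(1) by (simp add: indecomposable_def)
  obtain n where n: "f ` (f ^^ n) ` Y = (f ^^ n) ` Y"
    using image_chain[OF f sY Y(2)] by blast
  let ?U = "(f ^^ n) ` Y" and ?K = "{x \<in> Y. (f ^^ n) x = 0}"
  note fn = mod_hom_funpow[OF f, of n]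
  have UY: "?U \<subseteq> Y"
    using mod_hom_in[OF fn] by blast
  have sU: "submodule G ?U"
    by (rule submodule_image[OF fn sY])
  have sK: "submodule G ?K"
    by (rule submodule_kernel[OF fn sY])
  have fnU: "(f ^^ n) ` ?U = ?U"
    by (rule funpow_image_fixed[OF n])
  \<comment> \<open>On the stable image the n-th power is onto, hence injective. This gives the
    trivial intersection with the kernel.\<close>
  have injU: "inj_on (f ^^ n) ?U"
    using surj_imp_inj[OF _ sU finite_dim_mono[OF Y(2) UY] fnU] fn fnU UY
    by (simp add: mod_hom_def image_subset_iff subset_iff)
  have "direct_sum G Y [?U, ?K]"
  proof (rule direct_sum_pairI[OF sU sK])
    show "?U \<inter> ?K \<subseteq> {0}"
    proof
      fix x assume x: "x \<in> ?U \<inter> ?K"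
      then have "(f ^^ n) x = (f ^^ n) 0"
        by (simp add: mod_hom_zero[OF fn sY])
      then show "x \<in> {0}"
        using inj_onD[OF injU, of x 0] x submodule_zero[OF sU] by blast
    qed
    show "Y = {a + b |a b. a \<in> ?U \<and> b \<in> ?K}"
    proof (intro equalityI subsetI)
      fix x assume x: "x \<in> Y"
      \<comment> \<open>The n-th power maps the stable image onto itself, so the image of
        \<open>x\<close> is also attained at some \<open>u\<close> in it, and \<open>x - u\<close>
        falls into the kernel.\<close>
      then obtain u where u: "u \<in> ?U" "(f ^^ n) x = (f ^^ n) u"
        using fnU by (metis (no_types, lifting) image_iff)
      then have "x - u \<in> ?K"
        using x UY by (auto simp: mod_hom_diff[OF fn sY] submodule_diff[OF sY])
      then have "u + (x - u) \<in> {a + b |a b. a \<in> ?U \<and> b \<in> ?K}"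
        using u(1) by blast
      then show "x \<in> {a + b |a b. a \<in> ?U \<and> b \<in> ?K}"
        by simp
    next
      fix x assume "x \<in> {a + b |a b. a \<in> ?U \<and> b \<in> ?K}"
      then show "x \<in> Y"
        using UY submodule_add[OF sY] by blast
    qed
  qed
  then consider "?U = {0}" | "?K = {0}"
    using Y(1) unfolding indecomposable_def by blast
  then show ?thesis
  proof cases
    case 1
    then have "\<forall>x\<in>Y. (f ^^ n) x = 0"
      by blast
    then show ?thesis
      by blast
  next
    case 2
    then have "inj_on (f ^^ n) Y"
      by (intro mod_hom_inj_onI[OF fn sY]) blast
    then have "?U = Y"
      by (rule inj_imp_surj[OF fn sY Y(2)])
    with n have "f ` Y = Y"
      by simp
    then show ?thesis
      using surj_imp_inj[OF f sY Y(2)] by (simp add: bij_betw_def)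
  qed
qed

text \<open>If \<open>g\<close> is not bijective, it is nilpotent by Fitting. A vector killed by
  \<open>f\<close> is fixed by \<open>g\<close>, hence by all its powers, hence zero.\<close>

lemma local_endomorphisms:
  assumes Y: "indecomposable G Y" "finite_dim Y"
    and f: "mod_hom G Y Y f" and g: "mod_hom G Y Y g" and fg: "\<And>x. x \<in> Y \<Longrightarrow> f x + g x = x"
  shows "bij_betw f Y Y \<or> bij_betw g Y Y"
proof (rule disjCI)
  assume "\<not> bij_betw g Y Y"
  then obtain n where n: "\<forall>x\<in>Y. (g ^^ n) x = 0"
    using fitting[OF Y g] by blast
  have sY: "submodule G Y"
    using Y(1) by (simp add: indecomposable_def)
  have "inj_on f Y"
  proof (rule mod_hom_inj_onI[OF f sY])
    fix x assume x: "x \<in> Y" "f x = 0"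
    then have "g x = x"
      using fg[of x] by simp
    then have "(g ^^ n) x = x"
      by (induction n) simp_all
    then show "x = 0"
      using n x(1) by simp
  qed
  then show "bij_betw f Y Y"
    using inj_imp_surj[OF f sY Y(2)] by (simp add: bij_betw_def)
qed

text \<open>Composing with the inverse of the whole sum turns the first summand and the remaining
  sum into two maps adding up to the identity. Locality makes one of them bijective, and the inverse
  is then cancelled again.\<close>

lemma local_endomorphisms_sum:
  assumes Y: "indecomposable G Y" "finite_dim Y" and "finite I"
    and "\<And>i. i \<in> I \<Longrightarrow> mod_hom G Y Y (h i)" and "bij_betw (\<lambda>x. \<Sum>i\<in>I. h i x) Y Y"
  shows "\<exists>i\<in>I. bij_betw (h i) Y Y"
  using assms(3-)
proof (induction I rule: finite_induct)
  case empty
  \<comment> \<open>The empty sum is the zero map, which is not bijective on a nonzero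
    module.\<close>
  have "submodule G Y" "Y \<noteq> {0}"
    using Y(1) by (auto simp: indecomposable_def)
  then obtain y where "y \<in> Y" "y \<noteq> 0"
    using submodule_zero by blast
  then show ?case
    using empty(2) by (auto simp: bij_betw_def)
next
  case (insert i I)
  have sY: "submodule G Y"
    using Y(1) by (simp add: indecomposable_def)
  let ?s = "\<lambda>x. h i x + (\<Sum>i\<in>I. h i x)"
  have s: "bij_betw ?s Y Y"
    using insert by simp
  have hi: "mod_hom G Y Y (h i)" and hI: "mod_hom G Y Y (\<lambda>x. \<Sum>i\<in>I. h i x)"
    using insert.prems(1) by (auto intro: mod_hom_sum[OF sY])
  have hs: "mod_hom G Y Y ?s"
    by (rule mod_hom_plus[OF hi hI sY])
  let ?r = "inv_into Y ?s"
  have r: "mod_hom G Y Y ?r"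
    by (rule mod_hom_inv_into[OF hs s sY])
  have br: "bij_betw ?r Y Y"
    by (rule bij_betw_inv_into[OF s])
  have cancel: "bij_betw k Y Y" if "bij_betw (\<lambda>x. ?r (k x)) Y Y" "mod_hom G Y Y k" for k
  proof -
    have "bij_betw (?s \<circ> (\<lambda>x. ?r (k x))) Y Y"
      using bij_betw_trans[OF that(1) s] .
    moreover have "(?s \<circ> (\<lambda>x. ?r (k x))) x = k x" if "x \<in> Y" for x
      using bij_betw_inv_into_right[OF s] mod_hom_in[OF \<open>mod_hom G Y Y k\<close> that] by simp
    ultimately show ?thesis
      using bij_betw_cong[of Y "?s \<circ> (\<lambda>x. ?r (k x))" k Y] by blast
  qed
  have "?r (h i x) + ?r (\<Sum>i\<in>I. h i x) = x" if "x \<in> Y" for x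
    using bij_betw_inv_into_left[OF s that] mod_hom_add[OF r] mod_hom_in[OF hi that]
      mod_hom_in[OF hI that] by simp
  then have "bij_betw (\<lambda>x. ?r (h i x)) Y Y \<or> bij_betw (\<lambda>x. ?r (\<Sum>i\<in>I. h i x)) Y Y"
    by (intro local_endomorphisms[OF Y] mod_hom_comp[OF _ r] hi hI)
  then show ?case
    using cancel[OF _ hi] cancel[OF _ hI] insert by blast
qed

text \<open>The exchange half of the Krull-Schmidt argument. Inserting the projections between
  \<open>a\<close> and \<open>b\<close> writes the identity of \<open>Y\<close> as a sum of
  endomorphisms, each passing through one summand. One of them is an automorphism, so
  \<open>Y\<close> splits off that summand, which is itself indecomposable.\<close>

lemma indecomposable_summand_isomorphic:
  assumes Y: "indecomposable G Y" "finite_dim Y" and Ws: "indecomposable_decomposition G M Ws"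
    and a: "mod_hom G Y M a" and b: "mod_hom G M Y b" and ba: "\<And>x. x \<in> Y \<Longrightarrow> b (a x) = x"
  shows "\<exists>W\<in>set Ws. isomorphic G Y W"
proof -
  let ?n = "length Ws"
  have ds: "direct_sum G M Ws"
    using Ws by (simp add: indecomposable_decomposition_def)
  have sY: "submodule G Y" and sM: "submodule G M"
    using Y(1) direct_sum_submodule[OF ds] by (simp_all add: indecomposable_def)
  obtain P where P: "\<And>i. i < ?n \<Longrightarrow> mod_hom G M (Ws ! i) (P i)"
      "\<And>x. x \<in> M \<Longrightarrow> (\<Sum>i<?n. P i x) = x"
    using direct_sum_projections[OF ds] by metis
  have WM: "Ws ! i \<subseteq> M" if "i < ?n" for i
    using direct_sum_component[OF ds that] by blast
  have Pa: "mod_hom G Y (Ws ! i) (\<lambda>x. P i (a x))" if "i < ?n" for i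
    by (rule mod_hom_comp[OF a P(1)[OF that]])
  have bW: "mod_hom G (Ws ! i) Y b" if "i < ?n" for i
    by (rule mod_hom_subset[OF b WM[OF that]]) simp
  have bsum: "b (\<Sum>i\<in>I. v i) = (\<Sum>i\<in>I. b (v i))" if "\<And>i. i \<in> I \<Longrightarrow> v i \<in> M" for v and I :: "nat set"
    using that
    by (induction I rule: infinite_finite_induct)
      (simp_all add: mod_hom_zero[OF b sM] mod_hom_add[OF b] submodule_sum[OF sM])
  have "(\<Sum>i<?n. b (P i (a x))) = x" if x: "x \<in> Y" for x
  proof -
    have "P i (a x) \<in> M" if "i \<in> {..<?n}" for i
      using mod_hom_in[OF Pa x] WM that by blast
    then have "b (\<Sum>i<?n. P i (a x)) = (\<Sum>i<?n. b (P i (a x)))"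
      by (rule bsum)
    then show ?thesis
      by (simp add: P(2)[OF mod_hom_in[OF a x]] ba[OF x])
  qed
  then have "bij_betw (\<lambda>x. \<Sum>i<?n. b (P i (a x))) Y Y"
    by (simp add: bij_betw_def inj_on_def)
  then obtain i where i: "i < ?n" "bij_betw (\<lambda>x. b (P i (a x))) Y Y"
    using local_endomorphisms_sum[OF Y, of "{..<?n}" "\<lambda>i x. b (P i (a x))"]
      mod_hom_comp[OF Pa bW] by auto
  define q W where "q x = P i (a x)" and "W = Ws ! i" for x
  have q: "mod_hom G Y W q" and bW: "mod_hom G W Y b" and bq: "bij_betw (\<lambda>x. b (q x)) Y Y"
    unfolding q_def W_def using Pa[OF i(1)] bW[OF i(1)] i(2) by simp_all
  have indW: "indecomposable G W"
    using Ws i(1) by (simp add: W_def indecomposable_decomposition_def)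
  then have sW: "submodule G W"
    by (simp add: indecomposable_def)
  have inj: "inj_on q Y"
    using bq by (auto simp: bij_betw_def inj_on_def)
  have sq: "submodule G (q ` Y)" and sK: "submodule G {x \<in> W. b x = 0}"
    by (rule submodule_image[OF q sY], rule submodule_kernel[OF bW sW])
  \<comment> \<open>The composite of \<open>q\<close> and \<open>b\<close> is an automorphism of
    \<open>Y\<close>, though perhaps not the identity. That is enough for the image of
    \<open>q\<close> to be a complement of the kernel of \<open>b\<close>.\<close>
  have "direct_sum G W [q ` Y, {x \<in> W. b x = 0}]"
  proof (rule direct_sum_pairI[OF sq sK])
    have "q y = 0" if "y \<in> Y" "b (q y) = 0" for y
    proof -
      have "b (q y) = b (q 0)"
        using that(2) mod_hom_zero[OF q sY] mod_hom_zero[OF bW sW] by simp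
      then have "y = 0"
        using inj_onD[of "\<lambda>x. b (q x)" Y y 0] bq that(1) submodule_zero[OF sY]
        by (simp add: bij_betw_def)
      then show ?thesis
        using mod_hom_zero[OF q sY] by simp
    qed
    then show "q ` Y \<inter> {x \<in> W. b x = 0} \<subseteq> {0}"
      by blast
    show "W = {s + t |s t. s \<in> q ` Y \<and> t \<in> {x \<in> W. b x = 0}}"
    proof (intro equalityI subsetI)
      fix x assume x: "x \<in> W"
      have "b x \<in> (\<lambda>x. b (q x)) ` Y"
        using bq mod_hom_in[OF bW x] by (simp add: bij_betw_def)
      then obtain y where y: "y \<in> Y" "b x = b (q y)"
        by blast
      then have "x - q y \<in> {x \<in> W. b x = 0}"
        using x mod_hom_in[OF q] by (auto simp: mod_hom_diff[OF bW sW] submodule_diff[OF sW])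
      then have "q y + (x - q y) \<in> {s + t |s t. s \<in> q ` Y \<and> t \<in> {x \<in> W. b x = 0}}"
        using y(1) by blast
      then show "x \<in> {s + t |s t. s \<in> q ` Y \<and> t \<in> {x \<in> W. b x = 0}}"
        by simp
    next
      fix x assume "x \<in> {s + t |s t. s \<in> q ` Y \<and> t \<in> {x \<in> W. b x = 0}}"
      then show "x \<in> W"
        using mod_hom_in[OF q] submodule_add[OF sW] by blast
    qed
  qed
  note D = direct_sum_pairD(3)[OF this] this
  have "q ` Y \<noteq> {0}"
  proof
    assume *: "q ` Y = {0}"
    have "y = 0" if "y \<in> Y" for y
    proof (rule inj_onD[OF inj])
      show "q y = q 0"
        using * that submodule_zero[OF sY] by (metis imageI singletonD)
    qed (use that submodule_zero[OF sY] in auto)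
    then have "Y = {0}"
      using submodule_zero[OF sY] by auto
    then show False
      using Y(1) by (simp add: indecomposable_def)
  qed
  then have ker: "{x \<in> W. b x = 0} = {0}"
    using D(2) indW unfolding indecomposable_def by blast
  have "W = q ` Y"
  proof (intro equalityI subsetI)
    fix x assume "x \<in> W"
    then obtain s t where "x = s + t" "s \<in> q ` Y" "t \<in> {x \<in> W. b x = 0}"
      using D(1) by blast
    then show "x \<in> q ` Y"
      unfolding ker by simp
  qed (use mod_hom_in[OF q] in blast)
  then have "isomorphic G Y W"
    unfolding isomorphic_def using inj q
    by (intro exI[of _ q]) (auto simp: bij_betw_def mod_hom_add mod_hom_scale mod_hom_act)
  then show ?thesis
    using i(1) W_def by auto
qed

section \<open>Permutation modules of the symmetric group\<close>

lemma sym_group_lcoset: "g <#\<^bsub>sym_group n\<^esub> C = (\<circ>) g ` C"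
  by (auto simp: l_coset_def sym_group_mult)

lemma sym_group_inv:
  assumes "g \<in> carrier (sym_group n)"
  shows "inv\<^bsub>sym_group n\<^esub> g = inv' g"
proof -
  have g: "g permutes {1..n}"
    using assms by (simp add: sym_group_carrier)
  show ?thesis
    by (rule group.inv_equality[OF sym_group_is_group])
      (use g in \<open>simp_all add: sym_group_mult sym_group_one sym_group_carrier permutes_inv
        permutes_inv_o\<close>)
qed

lemma sym_group_act: "g \<in> carrier (sym_group n) \<Longrightarrow> act (sym_group n) g f C = f ((\<circ>) (inv' g) ` C)"
  by (simp add: act_def sym_group_lcoset sym_group_inv)

lemma inj_comp_left: "g permutes A \<Longrightarrow> inj ((\<circ>) g)"
  by (rule injI) (metis comp_assoc id_comp permutes_inv_o(2))

lemma comp_image_inv: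
  assumes "g permutes A"
  shows "(\<circ>) g ` (\<circ>) (inv' g) ` C = C" "(\<circ>) (inv' g) ` (\<circ>) g ` C = C"
  by (simp_all add: image_image comp_assoc[symmetric] permutes_inv_o[OF assms])

lemma act_indicator:
  assumes "g \<in> carrier (sym_group n)"
  shows "act (sym_group n) g (indicator {C}) = indicator {g <#\<^bsub>sym_group n\<^esub> C}"
proof
  fix D
  have g: "g permutes {1..n}"
    using assms by (simp add: sym_group_carrier)
  have "(\<circ>) (inv' g) ` D = C \<longleftrightarrow> D = (\<circ>) g ` C"
    using comp_image_inv[OF g] by metis
  then show "act (sym_group n) g (indicator {C}) D = indicator {g <#\<^bsub>sym_group n\<^esub> C} D"
    by (simp add: sym_group_act[OF assms] sym_group_lcoset indicator_def)
qed

lemma lcosets_sym_group: "C \<in> lcosets\<^bsub>sym_group n\<^esub> H \<longleftrightarrow> (\<exists>g. g permutes {1..n} \<and> C = (\<circ>) g ` H)"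
  by (auto simp: LCOSETS_def sym_group_carrier sym_group_lcoset)

lemma comp_image_lcosets_iff:
  assumes "g permutes {1..n}"
  shows "(\<circ>) g ` C \<in> lcosets\<^bsub>sym_group n\<^esub> H \<longleftrightarrow> C \<in> lcosets\<^bsub>sym_group n\<^esub> H"
proof -
  have *: "(\<circ>) h ` D \<in> lcosets\<^bsub>sym_group n\<^esub> H" if "D \<in> lcosets\<^bsub>sym_group n\<^esub> H" "h permutes {1..n}" for D h
    using that by (auto simp: lcosets_sym_group image_image comp_assoc[symmetric]
        intro: permutes_compose)
  show ?thesis
    using *[OF _ assms] *[OF _ permutes_inv[OF assms], of "(\<circ>) g ` C"] comp_image_inv(2)[OF assms]
    by metis
qed

lemma finite_carrier_sym_group: "finite (carrier (sym_group n))"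
  by (simp add: sym_group_def finite_permutations)

lemma finite_lcosets_sym_group: "finite (lcosets\<^bsub>sym_group n\<^esub> H)"
  by (simp add: LCOSETS_def finite_carrier_sym_group)

lemma submodule_permutation_module: "submodule (sym_group n) (permutation_module (sym_group n) H)"
proof (rule submoduleI)
  fix g and f :: "(nat \<Rightarrow> nat) set \<Rightarrow> 'a"
  assume g: "g \<in> carrier (sym_group n)" and "f \<in> permutation_module (sym_group n) H"
  then show "act (sym_group n) g f \<in> permutation_module (sym_group n) H"
    using comp_image_lcosets_iff[OF permutes_inv[of g "{1..n}"], of _ H]
    by (simp add: permutation_module_def sym_group_act[OF g] sym_group_carrier)
qed (simp_all add: permutation_module_def scale_fun_def plus_fun_apply zero_fun_apply)

lemma sum_fun_apply: "(\<Sum>i\<in>I. f i) x = (\<Sum>i\<in>I. f i x)"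
  by (induction I rule: infinite_finite_induct) (simp_all add: plus_fun_apply zero_fun_apply)

lemma permutation_module_expand:
  assumes "f \<in> permutation_module (sym_group n) H"
  shows "f = (\<Sum>C\<in>lcosets\<^bsub>sym_group n\<^esub> H. scale_fun (f C) (indicator {C}))"
proof
  fix D
  have "(\<Sum>C\<in>lcosets\<^bsub>sym_group n\<^esub> H. f C * indicator {C} D)
      = (\<Sum>C\<in>lcosets\<^bsub>sym_group n\<^esub> H. if C = D then f D else 0)"
    by (rule sum.cong) (auto simp: indicator_def)
  then show "f D = (\<Sum>C\<in>lcosets\<^bsub>sym_group n\<^esub> H. scale_fun (f C) (indicator {C})) D"
    using assms finite_lcosets_sym_group[of n H]
    by (simp add: sum_fun_apply scale_fun_def permutation_module_def)
qed

lemma finite_dim_permutation_module: "finite_dim (permutation_module (sym_group n) H)"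
  unfolding finite_dim_def
proof (intro exI conjI subsetI)
  let ?T = "(\<lambda>C. indicator {C}) ` (lcosets\<^bsub>sym_group n\<^esub> H)"
  show "finite ?T"
    by (simp add: finite_lcosets_sym_group)
  fix f :: "(nat \<Rightarrow> nat) set \<Rightarrow> 'a" assume f: "f \<in> permutation_module (sym_group n) H"
  have "(\<Sum>C\<in>lcosets\<^bsub>sym_group n\<^esub> H. scale_fun (f C) (indicator {C})) \<in> fun_space.span ?T"
    by (intro fun_space.span_sum fun_space.span_scale fun_space.span_base imageI)
  then show "f \<in> fun_space.span ?T"
    using permutation_module_expand[OF f] by simp
qed

lemma permutation_module_eqI:
  assumes "f \<in> permutation_module (sym_group n) H" "f' \<in> permutation_module (sym_group n) H"
    and "\<And>g. g permutes {1..n} \<Longrightarrow> f (g <#\<^bsub>sym_group n\<^esub> H) = f' (g <#\<^bsub>sym_group n\<^esub> H)"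
  shows "f = f'"
proof
  fix C
  show "f C = f' C"
  proof (cases "C \<in> lcosets\<^bsub>sym_group n\<^esub> H")
    case True
    then show ?thesis
      using assms(3) by (auto simp: lcosets_sym_group sym_group_lcoset)
  next
    case False
    then show ?thesis
      using assms(1,2) by (simp add: permutation_module_def)
  qed
qed

lemma lcoset_comp_member:
  assumes "subgroup H (sym_group n)" "h \<in> H"
  shows "(g \<circ> h) <#\<^bsub>sym_group n\<^esub> H = g <#\<^bsub>sym_group n\<^esub> H"
proof -
  have "h <#\<^bsub>sym_group n\<^esub> H = H"
    using group.coset_join3[OF sym_group_is_group _ assms] subgroup.mem_carrier[OF assms] by simp
  then show ?thesis
    by (metis (no_types, lifting) sym_group_lcoset image_comp comp_apply comp_assoc image_cong)
qed

lemma lcoset_eqD: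
  assumes "subgroup H (sym_group n)" "g <#\<^bsub>sym_group n\<^esub> H = g' <#\<^bsub>sym_group n\<^esub> H"
  obtains h where "h \<in> H" "g = g' \<circ> h"
proof -
  have "id \<in> H"
    using subgroup.one_closed[OF assms(1)] by (simp add: sym_group_one)
  then have "g \<in> (\<circ>) g ` H"
    by (rule image_eqI[rotated]) simp
  then show ?thesis
    using assms(2) that by (auto simp: sym_group_lcoset)
qed

section \<open>Homomorphisms between permutation modules\<close>

text \<open>The intertwining operator of the trivial double coset. For \<open>L\<close> inside
  \<open>H\<close> it pulls functions back along the projection of cosets; for \<open>H\<close>
  inside \<open>L\<close> it sums over the fibres (transfer). Whether two cosets meet is invariant
  under left translation, which makes the operator equivariant. The value 0 off the cosets of
  \<open>L\<close> keeps the result in the permutation module.\<close>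

definition hecke ::
    "nat \<Rightarrow> (nat \<Rightarrow> nat) set \<Rightarrow> (nat \<Rightarrow> nat) set \<Rightarrow>
      ((nat \<Rightarrow> nat) set \<Rightarrow> 'k::field) \<Rightarrow> ((nat \<Rightarrow> nat) set \<Rightarrow> 'k)"
  where "hecke n H L f = (\<lambda>C. if C \<in> lcosets\<^bsub>sym_group n\<^esub> L
    then \<Sum>D\<in>{D \<in> lcosets\<^bsub>sym_group n\<^esub> H. D \<inter> C \<noteq> {}}. f D else 0)"

lemma mod_hom_hecke:
  "mod_hom (sym_group n) (permutation_module (sym_group n) H) (permutation_module (sym_group n) L)
    (hecke n H L)"
  unfolding mod_hom_def
proof (intro conjI ballI allI)
  fix f f' :: "(nat \<Rightarrow> nat) set \<Rightarrow> 'a" and c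
  show "hecke n H L f \<in> permutation_module (sym_group n) L"
    by (simp add: hecke_def permutation_module_def)
  show "hecke n H L (f + f') = hecke n H L f + hecke n H L f'"
    by (simp add: hecke_def fun_eq_iff plus_fun_apply sum.distrib)
  show "hecke n H L (scale_fun c f) = scale_fun c (hecke n H L f)"
    by (simp add: hecke_def fun_eq_iff scale_fun_def sum_distrib_left)
next
  fix g and f :: "(nat \<Rightarrow> nat) set \<Rightarrow> 'a"
  assume g: "g \<in> carrier (sym_group n)"
  then have p: "g permutes {1..n}" and pi: "inv' g permutes {1..n}"
    by (simp_all add: sym_group_carrier permutes_inv)
  let ?i = "(`) ((\<circ>) (inv' g))"
  show "hecke n H L (act (sym_group n) g f) = act (sym_group n) g (hecke n H L f)"
  proof
    fix C :: "(nat \<Rightarrow> nat) set"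
    have int: "?i D \<inter> ?i C \<noteq> {} \<longleftrightarrow> D \<inter> C \<noteq> {}" for D
      by (simp add: image_Int[OF inj_comp_left[OF pi], symmetric])
    have "bij_betw ?i {D \<in> lcosets\<^bsub>sym_group n\<^esub> H. D \<inter> C \<noteq> {}}
        {D \<in> lcosets\<^bsub>sym_group n\<^esub> H. D \<inter> ?i C \<noteq> {}}"
    proof (rule bij_betw_byWitness[where f' = "(`) ((\<circ>) g)"])
      have "D \<inter> ?i C \<noteq> {} \<longleftrightarrow> (\<circ>) g ` D \<inter> C \<noteq> {}" for D
        using int[of "(\<circ>) g ` D"] comp_image_inv(2)[OF p] by metis
      then show "(`) ((\<circ>) g) ` {D \<in> lcosets\<^bsub>sym_group n\<^esub> H. D \<inter> ?i C \<noteq> {}}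
          \<subseteq> {D \<in> lcosets\<^bsub>sym_group n\<^esub> H. D \<inter> C \<noteq> {}}"
        by (auto simp: comp_image_lcosets_iff[OF p])
      show "?i ` {D \<in> lcosets\<^bsub>sym_group n\<^esub> H. D \<inter> C \<noteq> {}}
          \<subseteq> {D \<in> lcosets\<^bsub>sym_group n\<^esub> H. D \<inter> ?i C \<noteq> {}}"
        by (auto simp: comp_image_lcosets_iff[OF pi])
    qed (simp_all add: comp_image_inv[OF p])
    then have "(\<Sum>D\<in>{D \<in> lcosets\<^bsub>sym_group n\<^esub> H. D \<inter> C \<noteq> {}}. f (?i D))
        = (\<Sum>D\<in>{D \<in> lcosets\<^bsub>sym_group n\<^esub> H. D \<inter> ?i C \<noteq> {}}. f D)"
      by (rule sum.reindex_bij_betw)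
    then show "hecke n H L (act (sym_group n) g f) C = act (sym_group n) g (hecke n H L f) C"
      by (simp add: hecke_def sym_group_act[OF g] comp_image_lcosets_iff[OF pi])
  qed
qed

text \<open>The transpositions \<open>(c a)\<close> with \<open>c \<in> X\<close> represent the cosets of \<open>L \<inter> H\<close> in \<open>L\<close>, because
  \<open>L \<inter> H\<close> is the stabilizer of \<open>a\<close> in \<open>L\<close> and \<open>X\<close> is the orbit of \<open>a\<close>.\<close>

lemma hecke_transpose:
  assumes H: "subgroup H (sym_group n)" and L: "subgroup L (sym_group n)"
    and orbit: "\<And>l. l \<in> L \<Longrightarrow> l a \<in> X" "\<And>c. c \<in> X \<Longrightarrow> transpose c a \<in> L"
    and stab: "\<And>l. l \<in> L \<Longrightarrow> l \<in> H \<longleftrightarrow> l a = a"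
    and g: "g permutes {1..n}"
  shows "hecke n H L f (g <#\<^bsub>sym_group n\<^esub> L)
    = (\<Sum>c\<in>X. f ((g \<circ> transpose c a) <#\<^bsub>sym_group n\<^esub> H))"
proof -
  have Lcomp: "k \<circ> l \<in> L" if "k \<in> L" "l \<in> L" for k l
    using subgroup.m_closed[OF L that] by (simp add: sym_group_mult)
  have perm: "l permutes {1..n}" if "l \<in> L" for l
    using subgroup.mem_carrier[OF L that] by (simp add: sym_group_carrier)
  have one: "id \<in> H" "id \<in> L"
    using subgroup.one_closed[OF H] subgroup.one_closed[OF L] by (simp_all add: sym_group_one)
  have invol: "transpose c a \<circ> (transpose c a \<circ> k) = k" for c and k :: "nat \<Rightarrow> nat"
    by (simp add: comp_assoc[symmetric])
  have inj_g: "k = l" if "g \<circ> k = g \<circ> l" for k l :: "nat \<Rightarrow> nat"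
    using that permutes_inv_o(2)[OF g] by (metis comp_assoc id_comp)
  have "bij_betw (\<lambda>c. (g \<circ> transpose c a) <#\<^bsub>sym_group n\<^esub> H) X
      {D \<in> lcosets\<^bsub>sym_group n\<^esub> H. D \<inter> (g <#\<^bsub>sym_group n\<^esub> L) \<noteq> {}}"
  proof (rule bij_betw_imageI)
    show "inj_on (\<lambda>c. (g \<circ> transpose c a) <#\<^bsub>sym_group n\<^esub> H) X"
    proof (rule inj_onI)
      fix c d assume cd: "c \<in> X" "d \<in> X"
        and "(g \<circ> transpose c a) <#\<^bsub>sym_group n\<^esub> H = (g \<circ> transpose d a) <#\<^bsub>sym_group n\<^esub> H"
      then obtain h where h: "h \<in> H" "g \<circ> transpose c a = g \<circ> transpose d a \<circ> h"
        using lcoset_eqD[OF H] by metis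
      then have *: "transpose c a = transpose d a \<circ> h"
        using inj_g by (simp add: comp_assoc)
      then have "h = transpose d a \<circ> transpose c a"
        using invol[of d h] by simp
      then have "h \<in> L"
        using Lcomp orbit(2) cd by simp
      then have "h a = a"
        using stab h(1) by blast
      then show "c = d"
        using fun_cong[OF *, of a] by simp
    qed
    show "(\<lambda>c. (g \<circ> transpose c a) <#\<^bsub>sym_group n\<^esub> H) ` X
        = {D \<in> lcosets\<^bsub>sym_group n\<^esub> H. D \<inter> (g <#\<^bsub>sym_group n\<^esub> L) \<noteq> {}}"
    proof (intro equalityI subsetI)
      fix D assume "D \<in> (\<lambda>c. (g \<circ> transpose c a) <#\<^bsub>sym_group n\<^esub> H) ` X"
      then obtain c where c: "c \<in> X" "D = (\<circ>) (g \<circ> transpose c a) ` H"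
        by (auto simp: sym_group_lcoset)
      have "g \<circ> transpose c a \<in> D"
        unfolding c(2) by (rule image_eqI[OF _ one(1)]) simp
      moreover have "g \<circ> transpose c a \<in> g <#\<^bsub>sym_group n\<^esub> L"
        using orbit(2)[OF c(1)] by (simp add: sym_group_lcoset)
      moreover have "D \<in> lcosets\<^bsub>sym_group n\<^esub> H"
        unfolding c(2) lcosets_sym_group using permutes_compose[OF perm[OF orbit(2)[OF c(1)]] g]
        by blast
      ultimately show "D \<in> {D \<in> lcosets\<^bsub>sym_group n\<^esub> H. D \<inter> (g <#\<^bsub>sym_group n\<^esub> L) \<noteq> {}}"
        by blast
    next
      fix D assume "D \<in> {D \<in> lcosets\<^bsub>sym_group n\<^esub> H. D \<inter> (g <#\<^bsub>sym_group n\<^esub> L) \<noteq> {}}"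
      then obtain x h l where *: "D = x <#\<^bsub>sym_group n\<^esub> H" "h \<in> H" "l \<in> L" "x \<circ> h = g \<circ> l"
        by (auto simp: lcosets_sym_group sym_group_lcoset)
      \<comment> \<open>Undoing by a transposition what \<open>l\<close> does to \<open>a\<close>
        leaves an element of \<open>L\<close> fixing \<open>a\<close>, hence one of
        \<open>H\<close>, which the coset absorbs.\<close>
      let ?k = "transpose (l a) a \<circ> l"
      have "?k \<in> L"
        using Lcomp orbit *(3) by blast
      then have k: "?k \<in> H"
        using stab by simp
      have "D = (g \<circ> l) <#\<^bsub>sym_group n\<^esub> H"
        using lcoset_comp_member[OF H *(2), of x] *(1,4) by simp
      also have "g \<circ> l = g \<circ> transpose (l a) a \<circ> ?k"
        using invol by (simp add: comp_assoc)
      also have "\<dots> <#\<^bsub>sym_group n\<^esub> H = (g \<circ> transpose (l a) a) <#\<^bsub>sym_group n\<^esub> H"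
        by (rule lcoset_comp_member[OF H k])
      finally show "D \<in> (\<lambda>c. (g \<circ> transpose c a) <#\<^bsub>sym_group n\<^esub> H) ` X"
        using orbit(1)[OF *(3)] by blast
    qed
  qed
  then have "(\<Sum>c\<in>X. f ((g \<circ> transpose c a) <#\<^bsub>sym_group n\<^esub> H))
      = (\<Sum>D\<in>{D \<in> lcosets\<^bsub>sym_group n\<^esub> H. D \<inter> (g <#\<^bsub>sym_group n\<^esub> L) \<noteq> {}}. f D)"
    by (rule sum.reindex_bij_betw)
  moreover have "g <#\<^bsub>sym_group n\<^esub> L \<in> lcosets\<^bsub>sym_group n\<^esub> L"
    using g by (auto simp: lcosets_sym_group sym_group_lcoset)
  ultimately show ?thesis
    by (simp add: hecke_def)
qed

text \<open>The orbit of \<open>a\<close> under \<open>L\<close> is a single point, so only one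
  coset of \<open>H\<close> meets a given coset of \<open>L\<close>: this is the pullback.\<close>

lemma hecke_restrict:
  assumes H: "subgroup H (sym_group n)" and L: "subgroup L (sym_group n)"
    and "L \<subseteq> H" "\<And>l. l \<in> L \<Longrightarrow> l a = a" and g: "g permutes {1..n}"
  shows "hecke n H L f (g <#\<^bsub>sym_group n\<^esub> L) = f (g <#\<^bsub>sym_group n\<^esub> H)"
  using hecke_transpose[OF H L, of a "{a}"] assms subgroup.one_closed[OF L]
  by (auto simp: sym_group_one)

text \<open>Pullback followed by summation over the fibres counts each value once per coset of
  \<open>L\<close> in \<open>H\<close>. The size of the orbit \<open>X\<close> is that index, since
  \<open>L\<close> is the stabilizer of \<open>a\<close> in \<open>H\<close>.\<close>

lemma hecke_index:
  assumes H: "subgroup H (sym_group n)" and L: "subgroup L (sym_group n)"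
    and orbit: "\<And>h. h \<in> H \<Longrightarrow> h a \<in> X" "\<And>c. c \<in> X \<Longrightarrow> transpose c a \<in> H"
    and stab: "\<And>h. h \<in> L \<longleftrightarrow> h \<in> H \<and> h a = a"
    and f: "f \<in> permutation_module (sym_group n) H"
  shows "hecke n L H (hecke n H L f) = scale_fun (of_nat (card X)) f"
proof (rule permutation_module_eqI)
  note M = submodule_permutation_module mod_hom_hecke
  show "hecke n L H (hecke n H L f) \<in> permutation_module (sym_group n) H"
    by (rule mod_hom_in[OF M(2) mod_hom_in[OF M(2) f]])
  show "scale_fun (of_nat (card X)) f \<in> permutation_module (sym_group n) H"
    by (rule submodule_scale[OF M(1) f])
  fix g assume g: "g permutes {1..n}"
  have "hecke n L H (hecke n H L f) (g <#\<^bsub>sym_group n\<^esub> H)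
      = (\<Sum>c\<in>X. hecke n H L f ((g \<circ> transpose c a) <#\<^bsub>sym_group n\<^esub> L))"
    by (rule hecke_transpose[OF L H, of a X]) (use orbit stab g in auto)
  also have "\<dots> = (\<Sum>c\<in>X. f (g <#\<^bsub>sym_group n\<^esub> H))"
  proof (rule sum.cong[OF refl])
    fix c assume "c \<in> X"
    then have c: "transpose c a \<in> H"
      by (rule orbit(2))
    then have "g \<circ> transpose c a permutes {1..n}"
      using subgroup.mem_carrier[OF H c] g by (simp add: sym_group_carrier permutes_compose)
    then have "hecke n H L f ((g \<circ> transpose c a) <#\<^bsub>sym_group n\<^esub> L)
        = f ((g \<circ> transpose c a) <#\<^bsub>sym_group n\<^esub> H)"
      by (intro hecke_restrict[OF H L, of a]) (use stab in auto)
    then show "hecke n H L f ((g \<circ> transpose c a) <#\<^bsub>sym_group n\<^esub> L) = f (g <#\<^bsub>sym_group n\<^esub> H)"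
      using lcoset_comp_member[OF H c] by simp
  qed
  finally show "hecke n L H (hecke n H L f) (g <#\<^bsub>sym_group n\<^esub> H)
      = scale_fun (of_nat (card X)) f (g <#\<^bsub>sym_group n\<^esub> H)"
    by (simp add: scale_fun_def)
qed

text \<open>A split injection instead of a complement: this describes a summand up to isomorphism,
  composes easily, and is the form that the exchange argument consumes.\<close>

definition direct_summand ::
    "('g, 'b) monoid_scheme \<Rightarrow> ('g set \<Rightarrow> 'k::field) set \<Rightarrow> ('g set \<Rightarrow> 'k) set \<Rightarrow> bool"
  where "direct_summand G V W \<longleftrightarrow>
    (\<exists>a b. mod_hom G V W a \<and> mod_hom G W V b \<and> (\<forall>x\<in>V. b (a x) = x))"

lemma direct_summand_trans:
  assumes "direct_summand G U V" "direct_summand G V W"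
  shows "direct_summand G U W"
proof -
  obtain a b where ab: "mod_hom G U V a" "mod_hom G V U b" "\<forall>x\<in>U. b (a x) = x"
    using assms(1) unfolding direct_summand_def by blast
  obtain c d where cd: "mod_hom G V W c" "mod_hom G W V d" "\<forall>x\<in>V. d (c x) = x"
    using assms(2) unfolding direct_summand_def by blast
  show ?thesis
    unfolding direct_summand_def
    by (rule exI[of _ "\<lambda>x. c (a x)"], rule exI[of _ "\<lambda>x. b (d x)"])
      (use ab cd mod_hom_in[OF ab(1)] in \<open>auto intro: mod_hom_comp\<close>)
qed

lemma direct_summand_index:
  assumes H: "subgroup H (sym_group n)" and L: "subgroup L (sym_group n)"
    and orbit: "\<And>h. h \<in> H \<Longrightarrow> h a \<in> X" "\<And>c. c \<in> X \<Longrightarrow> transpose c a \<in> H"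
    and stab: "\<And>h. h \<in> L \<longleftrightarrow> h \<in> H \<and> h a = a"
    and "of_nat (card X) \<noteq> (0 :: 'k::field)"
  shows "direct_summand (sym_group n) (permutation_module (sym_group n) H :: (_ \<Rightarrow> 'k) set)
    (permutation_module (sym_group n) L)"
  unfolding direct_summand_def
proof (intro exI conjI ballI)
  note M = submodule_permutation_module mod_hom_hecke
  let ?b = "\<lambda>x. scale_fun (1 / of_nat (card X) :: 'k) (hecke n L H x)"
  show "mod_hom (sym_group n) (permutation_module (sym_group n) H)
      (permutation_module (sym_group n) L) (hecke n H L)"
    by (rule M(2))
  show "mod_hom (sym_group n) (permutation_module (sym_group n) L)
      (permutation_module (sym_group n) H) ?b"
    by (rule mod_hom_scaled[OF M(2,1)])
  fix x :: "_ \<Rightarrow> 'k" assume "x \<in> permutation_module (sym_group n) H"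
  then show "?b (hecke n H L x) = x"
    using hecke_index[OF H L, of a X x] orbit stab assms(6) by simp
qed

section \<open>Tableaux\<close>

definition diagram :: "nat list \<Rightarrow> (nat \<times> nat) set"
  where "diagram \<mu> = (SIGMA i:{..<length \<mu>}. {..<\<mu> ! i})"

text \<open>Row and column of an entry of the initial tableau, meaningful for entries from 1 to
  \<open>sum_list \<mu>\<close>. Stabilizing rows or columns becomes a condition on the first or
  second component.\<close>

definition cell :: "nat list \<Rightarrow> nat \<Rightarrow> nat \<times> nat"
  where "cell \<mu> = inv_into (diagram \<mu>) (\<lambda>(i, j). initial_tableau \<mu> i j)"

lemma sum_list_take_mono: "i \<le> i' \<Longrightarrow> sum_list (take i \<mu>) \<le> sum_list (take i' (\<mu> :: nat list))"
  by (metis le_add1 le_add_diff_inverse sum_list_append take_add)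

lemma sum_list_take_Suc:
  "i < length \<mu> \<Longrightarrow> sum_list (take (Suc i) \<mu>) = sum_list (take i \<mu>) + (\<mu> ! i :: nat)"
  by (simp add: take_Suc_conv_app_nth)

text \<open>Rows occupy consecutive disjoint intervals, which gives injectivity; surjectivity
  follows by counting.\<close>

lemma bij_betw_initial_tableau:
  "bij_betw (\<lambda>(i, j). initial_tableau \<mu> i j) (diagram \<mu>) {1..sum_list \<mu>}"
proof (rule bij_betw_imageI)
  have less: "initial_tableau \<mu> i j < initial_tableau \<mu> i' j'"
    if "i < i'" "i < length \<mu>" "j < \<mu> ! i" for i j i' j'
    using sum_list_take_mono[of "Suc i" i' \<mu>] sum_list_take_Suc[of i \<mu>] that
    by (simp add: initial_tableau_def)
  show inj: "inj_on (\<lambda>(i, j). initial_tableau \<mu> i j) (diagram \<mu>)"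
  proof (rule inj_onI, clarify)
    fix i j i' j'
    assume *: "(i, j) \<in> diagram \<mu>" "(i', j') \<in> diagram \<mu>"
      "initial_tableau \<mu> i j = initial_tableau \<mu> i' j'"
    then have "i = i'"
      using less[of i i' j j'] less[of i' i j' j] by (cases i i' rule: linorder_cases) (auto simp: diagram_def)
    then show "i = i' \<and> j = j'"
      using *(3) by (simp add: initial_tableau_def)
  qed
  have "card (diagram \<mu>) = card {1..sum_list \<mu>}"
    by (simp add: diagram_def sum_list_sum_nth atLeast0LessThan)
  then have "card ((\<lambda>(i, j). initial_tableau \<mu> i j) ` diagram \<mu>) = card {1..sum_list \<mu>}"
    by (simp only: card_image[OF inj])
  moreover have "(\<lambda>(i, j). initial_tableau \<mu> i j) ` diagram \<mu> \<subseteq> {1..sum_list \<mu>}"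
  proof clarify
    fix i j assume "(i, j) \<in> diagram \<mu>"
    then show "initial_tableau \<mu> i j \<in> {1..sum_list \<mu>}"
      using sum_list_take_mono[of "Suc i" "length \<mu>" \<mu>] sum_list_take_Suc[of i \<mu>]
      by (auto simp: diagram_def initial_tableau_def)
  qed
  ultimately show "(\<lambda>(i, j). initial_tableau \<mu> i j) ` diagram \<mu> = {1..sum_list \<mu>}"
    by (intro card_subset_eq) auto
qed

lemma cell_initial_tableau: "i < length \<mu> \<Longrightarrow> j < \<mu> ! i \<Longrightarrow> cell \<mu> (initial_tableau \<mu> i j) = (i, j)"
  using bij_betw_inv_into_left[OF bij_betw_initial_tableau, of "(i, j)" \<mu>]
  by (simp add: cell_def diagram_def)

lemma initial_tableau_in: "i < length \<mu> \<Longrightarrow> j < \<mu> ! i \<Longrightarrow> initial_tableau \<mu> i j \<in> {1..sum_list \<mu>}"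
  using bij_betw_apply[OF bij_betw_initial_tableau, of "(i, j)" \<mu>]
  by (simp add: diagram_def)

lemma initial_tableau_cell:
  assumes "x \<in> {1..sum_list \<mu>}"
  shows "initial_tableau \<mu> (fst (cell \<mu> x)) (snd (cell \<mu> x)) = x"
    and "fst (cell \<mu> x) < length \<mu>" and "snd (cell \<mu> x) < \<mu> ! fst (cell \<mu> x)"
  using bij_betw_inv_into_right[OF bij_betw_initial_tableau assms]
    bij_betw_apply[OF bij_betw_inv_into[OF bij_betw_initial_tableau] assms]
  by (auto simp: cell_def diagram_def split: prod.splits)

lemma tableau_row_initial:
  assumes "i < length \<mu>"
  shows "tableau_row \<mu> (initial_tableau \<mu>) i = {x \<in> {1..sum_list \<mu>}. fst (cell \<mu> x) = i}"
proof (intro equalityI subsetI)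
  fix x assume "x \<in> tableau_row \<mu> (initial_tableau \<mu>) i"
  then show "x \<in> {x \<in> {1..sum_list \<mu>}. fst (cell \<mu> x) = i}"
    unfolding tableau_row_def using assms initial_tableau_in cell_initial_tableau by auto
next
  fix x assume "x \<in> {x \<in> {1..sum_list \<mu>}. fst (cell \<mu> x) = i}"
  then show "x \<in> tableau_row \<mu> (initial_tableau \<mu>) i"
    using initial_tableau_cell[of x \<mu>] unfolding tableau_row_def by force
qed

lemma tableau_column_initial:
  "tableau_column \<mu> (initial_tableau \<mu>) j = {x \<in> {1..sum_list \<mu>}. snd (cell \<mu> x) = j}"
proof (intro equalityI subsetI)
  fix x assume "x \<in> tableau_column \<mu> (initial_tableau \<mu>) j"
  then show "x \<in> {x \<in> {1..sum_list \<mu>}. snd (cell \<mu> x) = j}"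
    unfolding tableau_column_def using initial_tableau_in cell_initial_tableau by auto
next
  fix x assume "x \<in> {x \<in> {1..sum_list \<mu>}. snd (cell \<mu> x) = j}"
  then show "x \<in> tableau_column \<mu> (initial_tableau \<mu>) j"
    using initial_tableau_cell[of x \<mu>] unfolding tableau_column_def by force
qed

section \<open>Young subgroups and column stabilizers as the permutations preserving a
  function\<close>

lemma permutes_fibres_iff:
  assumes "\<sigma> permutes A" "finite A" "f ` A \<subseteq> I"
  shows "(\<forall>i\<in>I. \<sigma> ` {x \<in> A. f x = i} = {x \<in> A. f x = i}) \<longleftrightarrow> (\<forall>x\<in>A. f (\<sigma> x) = f x)"
proof
  assume "\<forall>i\<in>I. \<sigma> ` {x \<in> A. f x = i} = {x \<in> A. f x = i}"
  then show "\<forall>x\<in>A. f (\<sigma> x) = f x"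
    using assms(3) by blast
next
  assume *: "\<forall>x\<in>A. f (\<sigma> x) = f x"
  show "\<forall>i\<in>I. \<sigma> ` {x \<in> A. f x = i} = {x \<in> A. f x = i}"
  proof
    fix i
    show "\<sigma> ` {x \<in> A. f x = i} = {x \<in> A. f x = i}"
      by (rule endo_inj_surj)
        (use assms * permutes_in_image[OF assms(1)] permutes_inj_on[OF assms(1)] in auto)
  qed
qed

lemma subgroup_fibres: "subgroup {\<sigma>. \<sigma> permutes {1..n} \<and> (\<forall>x\<in>{1..n}. f (\<sigma> x) = f x)} (sym_group n)"
proof (rule group.subgroupI[OF sym_group_is_group])
  fix \<sigma> assume s: "\<sigma> \<in> {\<sigma>. \<sigma> permutes {1..n} \<and> (\<forall>x\<in>{1..n}. f (\<sigma> x) = f x)}"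
  then have p: "\<sigma> permutes {1..n}"
    by blast
  have "f (inv' \<sigma> x) = f x" if "x \<in> {1..n}" for x
    using s that permutes_in_image[OF permutes_inv[OF p], of x] permutes_inverses(1)[OF p, of x]
    by (metis (mono_tags, lifting) mem_Collect_eq)
  then show "inv\<^bsub>sym_group n\<^esub> \<sigma> \<in> {\<sigma>. \<sigma> permutes {1..n} \<and> (\<forall>x\<in>{1..n}. f (\<sigma> x) = f x)}"
    using p by (simp add: sym_group_inv sym_group_carrier permutes_inv)
next
  have "id \<in> {\<sigma>. \<sigma> permutes {1..n} \<and> (\<forall>x\<in>{1..n}. f (\<sigma> x) = f x)}"
    by (simp add: permutes_id)
  then show "{\<sigma>. \<sigma> permutes {1..n} \<and> (\<forall>x\<in>{1..n}. f (\<sigma> x) = f x)} \<noteq> {}"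
    by blast
next
  fix \<sigma> \<tau>
  assume *: "\<sigma> \<in> {\<sigma>. \<sigma> permutes {1..n} \<and> (\<forall>x\<in>{1..n}. f (\<sigma> x) = f x)}"
    "\<tau> \<in> {\<sigma>. \<sigma> permutes {1..n} \<and> (\<forall>x\<in>{1..n}. f (\<sigma> x) = f x)}"
  then have "\<tau> x \<in> {1..n}" if "x \<in> {1..n}" for x
    using permutes_in_image[of \<tau> "{1..n}"] that by simp
  with * show "\<sigma> \<otimes>\<^bsub>sym_group n\<^esub> \<tau> \<in> {\<sigma>. \<sigma> permutes {1..n} \<and> (\<forall>x\<in>{1..n}. f (\<sigma> x) = f x)}"
    by (simp add: sym_group_mult permutes_compose)
qed (auto simp: sym_group_carrier)

lemma young_subgroup_eq:
  assumes "sum_list \<mu> = n"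
  shows "young_subgroup n \<mu>
    = {\<sigma>. \<sigma> permutes {1..n} \<and> (\<forall>x\<in>{1..n}. fst (cell \<mu> (\<sigma> x)) = fst (cell \<mu> x))}"
proof -
  have "(\<forall>i<length \<mu>. \<sigma> ` tableau_row \<mu> (initial_tableau \<mu>) i = tableau_row \<mu> (initial_tableau \<mu>) i)
      \<longleftrightarrow> (\<forall>x\<in>{1..n}. fst (cell \<mu> (\<sigma> x)) = fst (cell \<mu> x))" if "\<sigma> permutes {1..n}" for \<sigma>
    using permutes_fibres_iff[OF that, of "\<lambda>x. fst (cell \<mu> x)" "{..<length \<mu>}"]
      initial_tableau_cell(2)[of _ \<mu>] assms by (auto simp: tableau_row_initial image_subset_iff)
  then show ?thesis
    by (auto simp: young_subgroup_def sym_group_carrier)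
qed

lemma column_stabilizer_eq:
  assumes "sum_list \<mu> = n"
  shows "column_stabilizer n \<mu> (initial_tableau \<mu>)
    = {\<sigma>. \<sigma> permutes {1..n} \<and> (\<forall>x\<in>{1..n}. snd (cell \<mu> (\<sigma> x)) = snd (cell \<mu> x))}"
proof -
  have "(\<forall>j. \<sigma> ` tableau_column \<mu> (initial_tableau \<mu>) j = tableau_column \<mu> (initial_tableau \<mu>) j)
      \<longleftrightarrow> (\<forall>x\<in>{1..n}. snd (cell \<mu> (\<sigma> x)) = snd (cell \<mu> x))" if "\<sigma> permutes {1..n}" for \<sigma>
    using permutes_fibres_iff[OF that, of "\<lambda>x. snd (cell \<mu> x)" UNIV] assms
    by (simp add: tableau_column_initial)
  then show ?thesis
    by (auto simp: column_stabilizer_def sym_group_carrier)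
qed

lemma subgroup_young: "sum_list \<mu> = n \<Longrightarrow> subgroup (young_subgroup n \<mu>) (sym_group n)"
  by (simp only: young_subgroup_eq) (rule subgroup_fibres)

lemma subgroup_column_stabilizer:
  "sum_list \<mu> = n \<Longrightarrow> subgroup (column_stabilizer n \<mu> (initial_tableau \<mu>)) (sym_group n)"
  by (simp only: column_stabilizer_eq) (rule subgroup_fibres)

lemma card_row:
  assumes "i < length \<mu>"
  shows "card {x \<in> {1..sum_list \<mu>}. fst (cell \<mu> x) = i} = \<mu> ! i"
proof -
  have "{x \<in> {1..sum_list \<mu>}. fst (cell \<mu> x) = i} = initial_tableau \<mu> i ` {..<\<mu> ! i}"
    using tableau_row_initial[OF assms] by (auto simp: tableau_row_def)
  moreover have "inj_on (initial_tableau \<mu> i) {..<\<mu> ! i}"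
    by (auto simp: inj_on_def initial_tableau_def)
  ultimately show ?thesis
    by (simp add: card_image)
qed

text \<open>If the rows \<open>< i\<close> meet every column that is long enough to have a cell in them, then the
  columns with no cell in row \<open>i\<close> are exhausted by these rows, so row \<open>i\<close> has to meet the others.\<close>

lemma transversal_rows:
  assumes sorted: "sorted_wrt (\<ge>) \<mu>" and n: "sum_list \<mu> = n"
    and card: "\<And>i. i < length \<mu> \<Longrightarrow> card {x \<in> {1..n}. q x = i} = \<mu> ! i"
    and inj: "\<And>a b. \<lbrakk>a \<in> {1..n}; b \<in> {1..n}; snd (cell \<mu> a) = snd (cell \<mu> b); q a = q b\<rbrakk> \<Longrightarrow> a = b"
    and "i < length \<mu>" "j < \<mu> ! i"
  shows "\<exists>x\<in>{1..n}. snd (cell \<mu> x) = j \<and> q x = i"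
  using assms(5,6)
proof (induction i arbitrary: j rule: less_induct)
  case (less i)
  let ?A = "{x \<in> {1..n}. q x = i}"
  let ?c = "\<lambda>x. snd (cell \<mu> x)"
  have injA: "inj_on ?c ?A"
  proof (rule inj_onI)
    fix a b assume "a \<in> ?A" "b \<in> ?A" "?c a = ?c b"
    then show "a = b"
      using inj[of a b] by simp
  qed
  have "?c ` ?A \<subseteq> {..<\<mu> ! i}"
  proof (rule ccontr)
    assume "\<not> ?c ` ?A \<subseteq> {..<\<mu> ! i}"
    then obtain x where x: "x \<in> {1..n}" "q x = i" "\<mu> ! i \<le> ?c x"
      by fastforce
    \<comment> \<open>\<open>?I\<close> collects the rows having a cell in the column of
      \<open>x\<close>. They all lie above row \<open>i\<close>, so by induction each is a value of
      \<open>q\<close> on that column, and \<open>i\<close> is one value more than the column has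
      entries.\<close>
    let ?j = "?c x" and ?I = "{k. k < length \<mu> \<and> ?c x < \<mu> ! k}"
    let ?col = "{y \<in> {1..n}. ?c y = ?c x}"
    have "k < i" if "k \<in> ?I" for k
    proof (rule ccontr)
      assume "\<not> k < i"
      then have "\<mu> ! k \<le> \<mu> ! i"
        using sorted_wrt_nth_less[OF sorted, of i k] that by (cases "i = k") auto
      then show False
        using x(3) that by simp
    qed
    then have I: "?I \<subseteq> q ` ?col"
      using less.IH by fastforce
    have "i \<in> q ` ?col" "i \<notin> ?I"
      using x by auto
    then have "insert i ?I \<subseteq> q ` ?col"
      using I by blast
    then have "card (insert i ?I) \<le> card ?col"
      by (rule surj_card_le[rotated]) simp
    moreover have "card ?col \<le> card ?I"
    proof (rule card_inj_on_le)
      show "inj_on (\<lambda>y. fst (cell \<mu> y)) ?col"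
      proof (rule inj_onI)
        fix y z assume "y \<in> ?col" "z \<in> ?col" "fst (cell \<mu> y) = fst (cell \<mu> z)"
        then show "y = z"
          using initial_tableau_cell(1)[of y \<mu>] initial_tableau_cell(1)[of z \<mu>] n by simp
      qed
      show "(\<lambda>y. fst (cell \<mu> y)) ` ?col \<subseteq> ?I"
      proof (rule image_subsetI)
        fix y assume "y \<in> ?col"
        then show "fst (cell \<mu> y) \<in> ?I"
          using initial_tableau_cell(2,3)[of y \<mu>] n by simp
      qed
    qed simp
    moreover have "card (insert i ?I) = Suc (card ?I)"
      using \<open>i \<notin> ?I\<close> by simp
    ultimately show False
      by simp
  qed
  moreover have "card (?c ` ?A) = \<mu> ! i"
    using card_image[OF injA] card less.prems(1) by simp
  ultimately have "?c ` ?A = {..<\<mu> ! i}"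
    by (intro card_subset_eq) auto
  then have "j \<in> ?c ` ?A"
    using less.prems(2) by simp
  then show ?case
    by auto
qed

text \<open>James's combinatorial lemma: if no two entries share both a column of the initial
  tableau and a row of its image under \<open>\<rho>\<close>, the tabloid of \<open>\<rho>\<close>
  arises from the initial one by a column permutation.\<close>

lemma column_stabilizer_transversal:
  assumes sorted: "sorted_wrt (\<ge>) \<mu>" and n: "sum_list \<mu> = n" and p: "\<rho> permutes {1..n}"
    and inj: "\<And>a b. \<lbrakk>a \<in> {1..n}; b \<in> {1..n}; snd (cell \<mu> a) = snd (cell \<mu> b);
      fst (cell \<mu> (inv' \<rho> a)) = fst (cell \<mu> (inv' \<rho> b))\<rbrakk> \<Longrightarrow> a = b"
  shows "\<exists>\<pi>\<in>column_stabilizer n \<mu> (initial_tableau \<mu>).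
    \<rho> <#\<^bsub>sym_group n\<^esub> young_subgroup n \<mu> = \<pi> <#\<^bsub>sym_group n\<^esub> young_subgroup n \<mu>"
proof -
  define q where "q x = fst (cell \<mu> (inv' \<rho> x))" for x
  have "card {x \<in> {1..n}. q x = i} = \<mu> ! i" if "i < length \<mu>" for i
  proof -
    have "{x \<in> {1..n}. q x = i} = \<rho> ` {x \<in> {1..n}. fst (cell \<mu> x) = i}"
    proof (intro equalityI subsetI)
      fix x assume "x \<in> {x \<in> {1..n}. q x = i}"
      then have "inv' \<rho> x \<in> {x \<in> {1..n}. fst (cell \<mu> x) = i}"
        using permutes_in_image[OF permutes_inv[OF p]] by (simp add: q_def)
      then show "x \<in> \<rho> ` {x \<in> {1..n}. fst (cell \<mu> x) = i}"
        by (rule image_eqI[rotated]) (simp add: permutes_inverses(1)[OF p])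
    qed (use permutes_in_image[OF p] permutes_inverses(2)[OF p] in \<open>auto simp: q_def\<close>)
    then show ?thesis
      using card_row[OF that] n by (simp add: card_image[OF permutes_inj_on[OF p]])
  qed
  moreover have "a = b"
    if "a \<in> {1..n}" "b \<in> {1..n}" "snd (cell \<mu> a) = snd (cell \<mu> b)" "q a = q b" for a b
    using inj[OF that(1-3)] that(4) by (simp add: q_def)
  ultimately have "\<exists>x\<in>{1..n}. snd (cell \<mu> x) = j \<and> q x = i" if "i < length \<mu>" "j < \<mu> ! i" for i j
    by (rule transversal_rows[where q = q, OF sorted n _ _ that])
  then have "\<forall>y\<in>{1..n}. \<exists>x\<in>{1..n}. snd (cell \<mu> x) = snd (cell \<mu> y) \<and> q x = fst (cell \<mu> y)"
    using initial_tableau_cell(2,3)[of _ \<mu>] n by simp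
  \<comment> \<open>Each \<open>y\<close> moves within its column, to the entry that the tableau of
    \<open>\<rho>\<close> has in the row of \<open>y\<close>. Here \<open>q\<close> is the row of an
    entry in that tableau.\<close>
  then obtain \<pi>' where \<pi>': "\<And>y. y \<in> {1..n} \<Longrightarrow> \<pi>' y \<in> {1..n} \<and>
      snd (cell \<mu> (\<pi>' y)) = snd (cell \<mu> y) \<and> q (\<pi>' y) = fst (cell \<mu> y)"
    by metis
  define \<pi> where "\<pi> y = (if y \<in> {1..n} then \<pi>' y else y)" for y
  have \<pi>: "\<pi> y \<in> {1..n}" "snd (cell \<mu> (\<pi> y)) = snd (cell \<mu> y)" "q (\<pi> y) = fst (cell \<mu> y)"
    if "y \<in> {1..n}" for y
    using \<pi>'[OF that] that by (simp_all only: \<pi>_def if_True)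
  have "inj_on \<pi> {1..n}"
  proof (rule inj_onI)
    fix x y assume "x \<in> {1..n}" "y \<in> {1..n}" "\<pi> x = \<pi> y"
    then have "cell \<mu> x = cell \<mu> y"
      using \<pi>[of x] \<pi>[of y] by (simp add: prod_eq_iff)
    then show "x = y"
      using initial_tableau_cell(1) n \<open>x \<in> {1..n}\<close> \<open>y \<in> {1..n}\<close> by metis
  qed
  then have "\<pi> ` {1..n} = {1..n}"
    using \<pi>(1) by (intro endo_inj_surj) auto
  then have perm: "\<pi> permutes {1..n}"
    using \<open>inj_on \<pi> {1..n}\<close> by (intro bij_imp_permutes) (auto simp: bij_betw_def \<pi>_def)
  have C: "\<pi> \<in> column_stabilizer n \<mu> (initial_tableau \<mu>)"
    using perm \<pi>(2) by (simp add: column_stabilizer_eq[OF n])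
  \<comment> \<open>The tableaux of \<open>\<pi>\<close> and \<open>\<rho>\<close> have the same
    entries in each row, so their quotient preserves the rows of the initial tableau.\<close>
  have "inv' \<pi> \<circ> \<rho> \<in> young_subgroup n \<mu>"
    unfolding young_subgroup_eq[OF n]
  proof (intro CollectI conjI ballI)
    show "inv' \<pi> \<circ> \<rho> permutes {1..n}"
      by (rule permutes_compose[OF p permutes_inv[OF perm]])
    fix x assume "x \<in> {1..n}"
    then have "inv' \<pi> (\<rho> x) \<in> {1..n}"
      using permutes_in_image[OF p] permutes_in_image[OF permutes_inv[OF perm]] by blast
    then have "fst (cell \<mu> (inv' \<pi> (\<rho> x))) = q (\<rho> x)"
      using \<pi>(3) permutes_inverses(1)[OF perm] by metis
    then show "fst (cell \<mu> ((inv' \<pi> \<circ> \<rho>) x)) = fst (cell \<mu> x)"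
      by (simp add: q_def permutes_inverses(2)[OF p])
  qed
  then have "(\<pi> \<circ> (inv' \<pi> \<circ> \<rho>)) <#\<^bsub>sym_group n\<^esub> young_subgroup n \<mu>
      = \<pi> <#\<^bsub>sym_group n\<^esub> young_subgroup n \<mu>"
    by (rule lcoset_comp_member[OF subgroup_young[OF n]])
  moreover have "\<pi> \<circ> (inv' \<pi> \<circ> \<rho>) = \<rho>"
    by (simp add: comp_assoc[symmetric] permutes_inv_o[OF perm])
  ultimately show ?thesis
    using C by metis
qed

section \<open>Existence of Young modules\<close>

text \<open>The signed column sum of the initial tableau as an operator. The polytabloid of that
  tableau is its value at the trivial coset.\<close>

definition column_antisymmetrizer ::
    "nat \<Rightarrow> nat list \<Rightarrow> ((nat \<Rightarrow> nat) set \<Rightarrow> 'k::field) \<Rightarrow> ((nat \<Rightarrow> nat) set \<Rightarrow> 'k)"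
  where "column_antisymmetrizer n \<mu> f =
    (\<Sum>\<pi>\<in>column_stabilizer n \<mu> (initial_tableau \<mu>).
      scale_fun (of_int (sign \<pi>)) (act (sym_group n) \<pi> f))"

lemma column_antisymmetrizer_sum:
  "column_antisymmetrizer n \<mu> (\<Sum>i\<in>I. f i) = (\<Sum>i\<in>I. column_antisymmetrizer n \<mu> (f i))"
  unfolding column_antisymmetrizer_def act_sum fun_space.scale_sum_right by (rule sum.swap)

lemma column_antisymmetrizer_scale:
  "column_antisymmetrizer n \<mu> (scale_fun c f) = scale_fun c (column_antisymmetrizer n \<mu> f)"
  by (simp add: column_antisymmetrizer_def act_scale fun_space.scale_sum_right mult.commute)

lemma column_antisymmetrizer_in:
  assumes "submodule (sym_group n) W" "f \<in> W"
  shows "column_antisymmetrizer n \<mu> f \<in> W"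
  unfolding column_antisymmetrizer_def
  by (intro submodule_sum[OF assms(1)] submodule_scale[OF assms(1)] submodule_act[OF assms(1)] assms(2))
    (simp add: column_stabilizer_def)

lemma column_antisymmetrizer_indicator:
  "column_antisymmetrizer n \<mu> (indicator {\<rho> <#\<^bsub>sym_group n\<^esub> C}) =
    (\<Sum>\<pi>\<in>column_stabilizer n \<mu> (initial_tableau \<mu>).
      scale_fun (of_int (sign \<pi>)) (indicator {(\<pi> \<circ> \<rho>) <#\<^bsub>sym_group n\<^esub> C}))"
  unfolding column_antisymmetrizer_def
proof (rule sum.cong[OF refl])
  fix \<pi> assume "\<pi> \<in> column_stabilizer n \<mu> (initial_tableau \<mu>)"
  then have "\<pi> \<in> carrier (sym_group n)"
    by (simp add: column_stabilizer_def)
  then show "scale_fun (of_int (sign \<pi>)) (act (sym_group n) \<pi> (indicator {\<rho> <#\<^bsub>sym_group n\<^esub> C}))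
      = scale_fun (of_int (sign \<pi>)) (indicator {(\<pi> \<circ> \<rho>) <#\<^bsub>sym_group n\<^esub> C})"
    by (simp add: act_indicator sym_group_lcoset image_image comp_assoc)
qed

text \<open>Right translation of the summation index. With a transposition it produces a change of
  sign; in general it moves a column-equivalent coset back to the trivial one.\<close>

lemma column_stabilizer_reindex:
  assumes n: "sum_list \<mu> = n" and \<tau>: "\<tau> \<in> column_stabilizer n \<mu> (initial_tableau \<mu>)"
  shows "(\<Sum>\<pi>\<in>column_stabilizer n \<mu> (initial_tableau \<mu>). F (\<pi> \<circ> \<tau>))
    = (\<Sum>\<pi>\<in>column_stabilizer n \<mu> (initial_tableau \<mu>). F \<pi>)"
proof -
  note C = subgroup_column_stabilizer[OF n]
  have p: "\<tau> permutes {1..n}" and i: "inv' \<tau> \<in> column_stabilizer n \<mu> (initial_tableau \<mu>)"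
    using subgroup.mem_carrier[OF C \<tau>] subgroup.m_inv_closed[OF C \<tau>]
    by (simp_all add: sym_group_carrier sym_group_inv)
  have "bij_betw (\<lambda>\<pi>. \<pi> \<circ> \<tau>) (column_stabilizer n \<mu> (initial_tableau \<mu>))
      (column_stabilizer n \<mu> (initial_tableau \<mu>))"
    by (rule bij_betw_byWitness[where f' = "\<lambda>\<pi>. \<pi> \<circ> inv' \<tau>"])
      (use subgroup.m_closed[OF C _ \<tau>] subgroup.m_closed[OF C _ i] in
        \<open>auto simp: sym_group_mult comp_assoc permutes_inv_o[OF p]\<close>)
  then show ?thesis
    by (rule sum.reindex_bij_betw)
qed

lemma sign_comp_column_stabilizer:
  assumes "\<pi> \<in> column_stabilizer n \<mu> t" "\<tau> \<in> column_stabilizer n \<mu> t'"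
  shows "sign (\<pi> \<circ> \<tau>) = sign \<pi> * sign \<tau>"
  by (rule sign_compose; rule sym_group_carrier'[of _ n])
    (use assms in \<open>simp_all add: column_stabilizer_def\<close>)

lemma polytabloid_id:
  "polytabloid n \<mu> id = column_antisymmetrizer n \<mu> (indicator {young_subgroup n \<mu>})"
proof -
  have "polytabloid n \<mu> id
      = column_antisymmetrizer n \<mu> (indicator {id <#\<^bsub>sym_group n\<^esub> young_subgroup n \<mu>})"
    unfolding column_antisymmetrizer_indicator by (simp add: polytabloid_def)
  then show ?thesis
    by (simp add: sym_group_lcoset)
qed

text \<open>If two entries share a column of the initial tableau and a row of the tableau of
  \<open>\<rho>\<close>, their transposition fixes the tabloid but changes the sign, so the sum
  equals its negative and vanishes. Otherwise the tabloid is a column permutation of the initial one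
  and the result is the polytabloid up to sign.\<close>

lemma column_antisymmetrizer_coset:
  assumes sorted: "sorted_wrt (\<ge>) \<mu>" and n: "sum_list \<mu> = n" and p: "\<rho> permutes {1..n}"
    and two: "(2 :: 'k::field) \<noteq> 0"
  shows "\<exists>c :: 'k. column_antisymmetrizer n \<mu> (indicator {\<rho> <#\<^bsub>sym_group n\<^esub> young_subgroup n \<mu>})
    = scale_fun c (polytabloid n \<mu> id)"
proof (cases "\<exists>a\<in>{1..n}. \<exists>b\<in>{1..n}. a \<noteq> b \<and> snd (cell \<mu> a) = snd (cell \<mu> b)
    \<and> fst (cell \<mu> (inv' \<rho> a)) = fst (cell \<mu> (inv' \<rho> b))")
  case True
  then obtain a b where ab: "a \<in> {1..n}" "b \<in> {1..n}" "a \<noteq> b" "snd (cell \<mu> a) = snd (cell \<mu> b)"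
      "fst (cell \<mu> (inv' \<rho> a)) = fst (cell \<mu> (inv' \<rho> b))"
    by blast
  let ?\<tau> = "transpose a b"
  let ?Y = "young_subgroup n \<mu>" and ?C = "column_stabilizer n \<mu> (initial_tableau \<mu>)"
  define S :: "_ \<Rightarrow> 'k" where "S = column_antisymmetrizer n \<mu> (indicator {\<rho> <#\<^bsub>sym_group n\<^esub> ?Y})"
  have \<tau>: "?\<tau> \<in> ?C"
    using ab permutes_swap_id[of a "{1..n}" b]
    by (auto simp: column_stabilizer_eq[OF n] transpose_def)
  \<comment> \<open>Conjugation by \<open>\<rho>\<close> turns the swap of two entries into a swap
    of two positions in one row, which the coset absorbs.\<close>
  have "inv' \<rho> \<circ> ?\<tau> \<circ> \<rho> \<in> ?Y"
    unfolding young_subgroup_eq[OF n]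
  proof (intro CollectI conjI ballI)
    show "inv' \<rho> \<circ> ?\<tau> \<circ> \<rho> permutes {1..n}"
      using p ab by (intro permutes_compose permutes_inv permutes_swap_id)
    have "fst (cell \<mu> (inv' \<rho> (?\<tau> y))) = fst (cell \<mu> (inv' \<rho> y))" for y
      using ab(5) by (simp add: transpose_def)
    then show "fst (cell \<mu> ((inv' \<rho> \<circ> ?\<tau> \<circ> \<rho>) x)) = fst (cell \<mu> x)" for x
      by (simp add: permutes_inverses(2)[OF p])
  qed
  then have "(\<rho> \<circ> (inv' \<rho> \<circ> ?\<tau> \<circ> \<rho>)) <#\<^bsub>sym_group n\<^esub> ?Y = \<rho> <#\<^bsub>sym_group n\<^esub> ?Y"
    by (rule lcoset_comp_member[OF subgroup_young[OF n]])
  moreover have "\<rho> \<circ> (inv' \<rho> \<circ> ?\<tau> \<circ> \<rho>) = ?\<tau> \<circ> \<rho>"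
    by (simp add: comp_assoc[symmetric] permutes_inv_o[OF p])
  ultimately have \<tau>\<rho>: "(?\<tau> \<circ> \<rho>) <#\<^bsub>sym_group n\<^esub> ?Y = \<rho> <#\<^bsub>sym_group n\<^esub> ?Y"
    by simp
  have coset: "(\<pi> \<circ> ?\<tau> \<circ> \<rho>) <#\<^bsub>sym_group n\<^esub> ?Y = (\<pi> \<circ> \<rho>) <#\<^bsub>sym_group n\<^esub> ?Y" for \<pi>
  proof -
    have "(\<pi> \<circ> ?\<tau> \<circ> \<rho>) <#\<^bsub>sym_group n\<^esub> ?Y = (\<circ>) \<pi> ` ((?\<tau> \<circ> \<rho>) <#\<^bsub>sym_group n\<^esub> ?Y)"
      by (simp add: sym_group_lcoset image_image comp_assoc)
    then show ?thesis
      unfolding \<tau>\<rho> by (simp add: sym_group_lcoset image_image comp_assoc)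
  qed
  have "S = (\<Sum>\<pi>\<in>?C. scale_fun (of_int (sign (\<pi> \<circ> ?\<tau>)))
      (indicator {(\<pi> \<circ> ?\<tau> \<circ> \<rho>) <#\<^bsub>sym_group n\<^esub> ?Y}))"
    unfolding S_def column_antisymmetrizer_indicator
    by (rule column_stabilizer_reindex[OF n \<tau>, symmetric])
  also have "\<dots> = (\<Sum>\<pi>\<in>?C. - scale_fun (of_int (sign \<pi>)) (indicator {(\<pi> \<circ> \<rho>) <#\<^bsub>sym_group n\<^esub> ?Y}))"
    using ab(3) by (intro sum.cong refl)
      (simp add: coset sign_comp_column_stabilizer[OF _ \<tau>] sign_swap_id)
  also have "\<dots> = - S"
    unfolding S_def column_antisymmetrizer_indicator by (rule sum_negf)
  finally have "scale_fun (1 + 1) S = 0"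
    unfolding fun_space.scale_left_distrib by (metis add.right_inverse fun_space.scale_one)
  then have "S = 0"
    using two by (simp del: fun_space.scale_left_distrib)
  then have "S = scale_fun 0 (polytabloid n \<mu> id)"
    by simp
  then show ?thesis
    unfolding S_def by blast
next
  case False
  let ?Y = "young_subgroup n \<mu>" and ?C = "column_stabilizer n \<mu> (initial_tableau \<mu>)"
  obtain \<pi> where \<pi>: "\<pi> \<in> ?C" "\<rho> <#\<^bsub>sym_group n\<^esub> ?Y = \<pi> <#\<^bsub>sym_group n\<^esub> ?Y"
    using column_stabilizer_transversal[OF sorted n p] False by blast
  have one: "(of_int (sign \<pi>) :: 'k) * of_int (sign \<pi>) = 1"
    by (simp flip: of_int_mult)
  have "column_antisymmetrizer n \<mu> (indicator {\<rho> <#\<^bsub>sym_group n\<^esub> ?Y}) =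
      (\<Sum>\<sigma>\<in>?C. scale_fun (of_int (sign \<sigma>)) (indicator {(\<sigma> \<circ> \<pi>) <#\<^bsub>sym_group n\<^esub> ?Y}))"
    unfolding \<pi>(2) by (rule column_antisymmetrizer_indicator)
  also have "\<dots> = (\<Sum>\<sigma>\<in>?C. scale_fun (of_int (sign \<pi>) :: 'k)
      (scale_fun (of_int (sign (\<sigma> \<circ> \<pi>))) (indicator {(\<sigma> \<circ> \<pi>) <#\<^bsub>sym_group n\<^esub> ?Y})))"
    by (intro sum.cong refl)
      (simp add: sign_comp_column_stabilizer[OF _ \<pi>(1)] mult.left_commute one)
  also have "\<dots> = (\<Sum>\<sigma>\<in>?C. scale_fun (of_int (sign \<pi>))
      (scale_fun (of_int (sign \<sigma>)) (indicator {\<sigma> <#\<^bsub>sym_group n\<^esub> ?Y})))"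
    by (rule column_stabilizer_reindex[OF n \<pi>(1)])
  also have "\<dots> = scale_fun (of_int (sign \<pi>)) (polytabloid n \<mu> id)"
    by (simp only: polytabloid_def fun_space.scale_sum_right comp_id id_apply)
  finally show ?thesis
    by blast
qed

lemma column_antisymmetrizer_multiple:
  assumes sorted: "sorted_wrt (\<ge>) \<mu>" and n: "sum_list \<mu> = n" and two: "(2 :: 'k::field) \<noteq> 0"
    and f: "(f :: _ \<Rightarrow> 'k) \<in> young_permutation_module n \<mu>"
  shows "\<exists>c. column_antisymmetrizer n \<mu> f = scale_fun c (polytabloid n \<mu> id)"
proof -
  let ?L = "lcosets\<^bsub>sym_group n\<^esub> young_subgroup n \<mu>"
  have "\<forall>C\<in>?L. \<exists>c :: 'k. column_antisymmetrizer n \<mu> (indicator {C}) = scale_fun c (polytabloid n \<mu> id)"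
    using column_antisymmetrizer_coset[OF sorted n _ two]
    by (auto simp: lcosets_sym_group simp flip: sym_group_lcoset[where n = n])
  then obtain c :: "_ \<Rightarrow> 'k" where c: "\<And>C. C \<in> ?L \<Longrightarrow>
      column_antisymmetrizer n \<mu> (indicator {C}) = scale_fun (c C) (polytabloid n \<mu> id)"
    by metis
  have "column_antisymmetrizer n \<mu> f
      = column_antisymmetrizer n \<mu> (\<Sum>C\<in>?L. scale_fun (f C) (indicator {C}))"
    using permutation_module_expand[of f n "young_subgroup n \<mu>"] f
    by (simp add: young_permutation_module_def)
  also have "\<dots> = (\<Sum>C\<in>?L. scale_fun (f C * c C) (polytabloid n \<mu> id))"
    by (simp add: column_antisymmetrizer_sum column_antisymmetrizer_scale c)
  also have "\<dots> = scale_fun (\<Sum>C\<in>?L. f C * c C) (polytabloid n \<mu> id)"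
    by (simp add: fun_space.scale_sum_left)
  finally show ?thesis
    by blast
qed

text \<open>Conjugation by \<open>\<sigma>\<close> carries one column stabilizer to the other and
  preserves signs. Hence a submodule containing the polytabloid of the initial tableau contains the
  whole Specht module.\<close>

lemma polytabloid_act:
  assumes n: "sum_list \<mu> = n" and s: "\<sigma> \<in> carrier (sym_group n)"
  shows "polytabloid n \<mu> \<sigma> = act (sym_group n) \<sigma> (polytabloid n \<mu> id)"
proof -
  let ?t = "initial_tableau \<mu>" and ?Y = "young_subgroup n \<mu>"
  let ?Cs = "column_stabilizer n \<mu> (\<lambda>i j. \<sigma> (?t i j))" and ?C = "column_stabilizer n \<mu> ?t"
  have p: "\<sigma> permutes {1..n}"
    using s by (simp add: sym_group_carrier)
  have col: "tableau_column \<mu> (\<lambda>i j. \<sigma> (?t i j)) j = \<sigma> ` tableau_column \<mu> ?t j" for j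
    by (auto simp: tableau_column_def)
  have "bij_betw (\<lambda>\<pi>. \<sigma> \<circ> \<pi> \<circ> inv' \<sigma>) ?C ?Cs"
  proof (rule bij_betw_byWitness[where f' = "\<lambda>\<pi>. inv' \<sigma> \<circ> \<pi> \<circ> \<sigma>"])
    show "\<forall>\<pi>\<in>?C. inv' \<sigma> \<circ> (\<sigma> \<circ> \<pi> \<circ> inv' \<sigma>) \<circ> \<sigma> = \<pi>" "\<forall>\<pi>\<in>?Cs. \<sigma> \<circ> (inv' \<sigma> \<circ> \<pi> \<circ> \<sigma>) \<circ> inv' \<sigma> = \<pi>"
      by (simp_all add: fun_eq_iff permutes_inverses[OF p])
    have conj_image: "(\<sigma> \<circ> \<pi> \<circ> inv' \<sigma>) ` \<sigma> ` X = \<sigma> ` \<pi> ` X"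
        "(inv' \<sigma> \<circ> \<pi> \<circ> \<sigma>) ` X = inv' \<sigma> ` \<pi> ` \<sigma> ` X" "inv' \<sigma> ` \<sigma> ` X = X" for X \<pi>
      by (simp_all add: image_image permutes_inverses[OF p])
    have "\<sigma> \<circ> \<pi> \<circ> inv' \<sigma> \<in> ?Cs" if "\<pi> \<in> ?C" for \<pi>
      using that p unfolding column_stabilizer_def
      by (simp add: sym_group_carrier col conj_image permutes_compose permutes_inv
          del: o_apply image_comp)
    then show "(\<lambda>\<pi>. \<sigma> \<circ> \<pi> \<circ> inv' \<sigma>) ` ?C \<subseteq> ?Cs"
      by blast
    have "inv' \<sigma> \<circ> \<pi> \<circ> \<sigma> \<in> ?C" if "\<pi> \<in> ?Cs" for \<pi>
      using that p unfolding column_stabilizer_def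
      by (simp add: sym_group_carrier col conj_image permutes_compose permutes_inv
          del: o_apply image_comp)
    then show "(\<lambda>\<pi>. inv' \<sigma> \<circ> \<pi> \<circ> \<sigma>) ` ?Cs \<subseteq> ?C"
      by blast
  qed
  then have "polytabloid n \<mu> \<sigma> = (\<Sum>\<pi>\<in>?C. scale_fun (of_int (sign (\<sigma> \<circ> \<pi> \<circ> inv' \<sigma>)))
      (indicator {((\<sigma> \<circ> \<pi> \<circ> inv' \<sigma>) \<circ> \<sigma>) <#\<^bsub>sym_group n\<^esub> ?Y}))"
    unfolding polytabloid_def by (rule sum.reindex_bij_betw[symmetric])
  also have "\<dots> = (\<Sum>\<pi>\<in>?C. scale_fun (of_int (sign \<pi>))
      (act (sym_group n) \<sigma> (indicator {\<pi> <#\<^bsub>sym_group n\<^esub> ?Y})))"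
  proof (rule sum.cong[OF refl])
    fix \<pi> assume "\<pi> \<in> ?C"
    then have \<pi>: "permutation \<pi>"
      using sym_group_carrier'[of \<pi> n] by (simp add: column_stabilizer_def)
    have \<sigma>: "permutation \<sigma>" "permutation (inv' \<sigma>)"
      using s sym_group_carrier' permutation_inverse by blast+
    have "sign (\<sigma> \<circ> \<pi> \<circ> inv' \<sigma>) = sign \<sigma> * sign \<pi> * sign \<sigma>"
      using \<pi> \<sigma> by (simp add: sign_compose permutation_compose sign_inverse)
    then have "sign (\<sigma> \<circ> \<pi> \<circ> inv' \<sigma>) = sign \<pi>"
      by (simp add: mult.commute mult.left_commute)
    moreover have "\<sigma> \<circ> \<pi> \<circ> inv' \<sigma> \<circ> \<sigma> = \<sigma> \<circ> \<pi>"
      by (simp add: fun_eq_iff permutes_inverses[OF p])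
    ultimately show "scale_fun (of_int (sign (\<sigma> \<circ> \<pi> \<circ> inv' \<sigma>)))
        (indicator {((\<sigma> \<circ> \<pi> \<circ> inv' \<sigma>) \<circ> \<sigma>) <#\<^bsub>sym_group n\<^esub> ?Y})
        = scale_fun (of_int (sign \<pi>)) (act (sym_group n) \<sigma> (indicator {\<pi> <#\<^bsub>sym_group n\<^esub> ?Y}))"
      using s by (simp add: act_indicator sym_group_lcoset image_image comp_assoc)
  qed
  also have "\<dots> = act (sym_group n) \<sigma> (polytabloid n \<mu> id)"
    by (simp add: polytabloid_def act_sum act_scale)
  finally show ?thesis .
qed

text \<open>The column antisymmetrizer maps all of \<open>M\<^sup>\<mu>\<close> into the line of the polytabloid, which is therefore
  contained in any summand on which the antisymmetrizer does not vanish.\<close>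

lemma is_young_module_exists:
  assumes sorted: "sorted_wrt (\<ge>) \<mu>" and n: "sum_list \<mu> = n" and two: "(2 :: 'k::field) \<noteq> 0"
  shows "\<exists>Y :: ((nat \<Rightarrow> nat) set \<Rightarrow> 'k) set. is_young_module n \<mu> Y"
proof -
  define M :: "((nat \<Rightarrow> nat) set \<Rightarrow> 'k) set" where "M = young_permutation_module n \<mu>"
  have "submodule (sym_group n) M" "finite_dim M"
    by (simp_all add: M_def young_permutation_module_def submodule_permutation_module
        finite_dim_permutation_module)
  then obtain Ws where Ws: "indecomposable_decomposition (sym_group n) M Ws"
    using indecomposable_decomposition_exists by blast
  then have ds: "direct_sum (sym_group n) M Ws"
    by (simp add: indecomposable_decomposition_def)
  obtain P where P: "\<And>i. i < length Ws \<Longrightarrow> mod_hom (sym_group n) M (Ws ! i) (P i)"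
      "\<And>x. x \<in> M \<Longrightarrow> (\<Sum>i<length Ws. P i x) = x"
    using direct_sum_projections[OF ds] by metis
  define v :: "_ \<Rightarrow> 'k" where "v = indicator {young_subgroup n \<mu>}"
  have "young_subgroup n \<mu> \<in> lcosets\<^bsub>sym_group n\<^esub> (young_subgroup n \<mu>)"
    unfolding lcosets_sym_group by (rule exI[of _ id]) (simp add: permutes_id)
  then have v: "v \<in> M"
    by (auto simp: v_def M_def young_permutation_module_def permutation_module_def indicator_def)
  have "v (young_subgroup n \<mu>) \<noteq> 0"
    by (simp add: v_def)
  then have "v \<noteq> 0"
    by (metis zero_fun_apply)
  then have ne: "0 < length Ws"
    using P(2)[OF v] by (cases Ws) auto
  let ?e = "polytabloid n \<mu> id :: _ \<Rightarrow> 'k"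
  \<comment> \<open>The polytabloid is the antisymmetrized trivial coset; splitting that coset into
    components leaves each antisymmetrized component a multiple of the polytabloid.\<close>
  have e: "?e = (\<Sum>i<length Ws. column_antisymmetrizer n \<mu> (P i v))"
    unfolding column_antisymmetrizer_sum[symmetric] P(2)[OF v] by (simp add: polytabloid_id v_def)
  have "\<exists>i<length Ws. ?e \<in> Ws ! i"
  proof (cases "\<exists>i<length Ws. column_antisymmetrizer n \<mu> (P i v) \<noteq> 0")
    case True
    then obtain i where i: "i < length Ws" "column_antisymmetrizer n \<mu> (P i v) \<noteq> 0"
      by blast
    note sub = direct_sum_nthD[OF ds i(1)]
    have Pi: "P i v \<in> Ws ! i"
      by (rule mod_hom_in[OF P(1)[OF i(1)] v])
    have "P i v \<in> M"
      by (rule direct_sum_component[OF ds i(1) Pi])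
    then obtain c where c: "column_antisymmetrizer n \<mu> (P i v) = scale_fun c ?e"
      using column_antisymmetrizer_multiple[OF sorted n two] unfolding M_def by blast
    then have "c \<noteq> 0"
      using i(2) by auto
    then have "?e = scale_fun (1 / c) (column_antisymmetrizer n \<mu> (P i v))"
      by (simp add: c)
    then show ?thesis
      using submodule_scale[OF sub column_antisymmetrizer_in[OF sub Pi]] i(1) by metis
  next
    case False
    \<comment> \<open>Then any summand contains it, and there is one because \<open>v\<close> is
      nonzero.\<close>
    then have "?e = 0"
      unfolding e by simp
    then show ?thesis
      using ne submodule_zero[OF direct_sum_nthD[OF ds ne]] by auto
  qed
  then obtain i where i: "i < length Ws" "?e \<in> Ws ! i"
    by blast
  note sub = direct_sum_nthD[OF ds i(1)]
  have "polytabloid n \<mu> ` carrier (sym_group n) \<subseteq> Ws ! i"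
  proof (rule image_subsetI)
    fix \<sigma> assume \<sigma>: "\<sigma> \<in> carrier (sym_group n)"
    show "polytabloid n \<mu> \<sigma> \<in> Ws ! i"
      unfolding polytabloid_act[OF n \<sigma>] by (rule submodule_act[OF sub \<sigma> i(2)])
  qed
  then have "specht_module n \<mu> \<subseteq> Ws ! i"
    unfolding specht_module_def by (rule fun_space.span_minimal[OF _ submodule_subspace[OF sub]])
  then show ?thesis
    using Ws i(1) unfolding is_young_module_def M_def by (metis nth_mem)
qed

text \<open>The existence theorem turns the chosen \<open>young_module\<close> into an actual
  summand of M of \<open>\<mu>\<close>. Since the multiplicity refers to an unspecified
  decomposition, an isomorphic copy is exhibited in every one.\<close>

lemma p_kostka_pos:
  assumes sorted: "sorted_wrt (\<ge>) \<mu>" and n: "sum_list \<mu> = n" and two: "(2 :: 'k::field) \<noteq> 0"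
    and summand: "direct_summand (sym_group n)
      (young_permutation_module n \<mu> :: (_ \<Rightarrow> 'k) set) (young_permutation_module n \<nu>)"
  shows "p_kostka TYPE('k) n \<nu> \<mu> > 0"
proof -
  let ?G = "sym_group n"
  let ?M = "young_permutation_module n \<mu> :: (_ \<Rightarrow> 'k) set"
  let ?N = "young_permutation_module n \<nu> :: (_ \<Rightarrow> 'k) set"
  let ?Y = "young_module n \<mu> :: (_ \<Rightarrow> 'k) set"
  have fd: "finite_dim ?M" "finite_dim ?N" "submodule ?G ?N"
    by (simp_all add: young_permutation_module_def submodule_permutation_module
        finite_dim_permutation_module)
  have "is_young_module n \<mu> ?Y"
    unfolding young_module_def using is_young_module_exists[OF sorted n two] by (rule someI_ex)
  then obtain Ws where Ws: "indecomposable_decomposition ?G ?M Ws" "?Y \<in> set Ws"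
    unfolding is_young_module_def by blast
  then obtain i where i: "i < length Ws" "Ws ! i = ?Y"
    by (metis in_set_conv_nth)
  have ind: "indecomposable ?G ?Y" and ds: "direct_sum ?G ?M Ws"
    using Ws by (simp_all add: indecomposable_decomposition_def)
  obtain P where P: "\<And>i. i < length Ws \<Longrightarrow> mod_hom ?G ?M (Ws ! i) (P i)"
      "\<And>v j. \<lbrakk>\<And>i. i < length Ws \<Longrightarrow> v i \<in> Ws ! i; j < length Ws\<rbrakk> \<Longrightarrow> P j (\<Sum>i<length Ws. v i) = v j"
    using direct_sum_projections[OF ds] by metis
  have YP: "y \<in> ?M" "P i y = y" if y: "y \<in> ?Y" for y
  proof -
    let ?v = "\<lambda>j. if j = i then y else 0"
    have v: "?v j \<in> Ws ! j" if "j < length Ws" for j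
      using y i(2) submodule_zero[OF direct_sum_nthD[OF ds that]] by auto
    have "(\<Sum>j<length Ws. ?v j) = y"
      using i(1) by simp
    then show "y \<in> ?M" "P i y = y"
      using direct_sum_sum_in[OF ds v] P(2)[OF v i(1)] by simp_all
  qed
  then have YM: "?Y \<subseteq> ?M"
    by blast
  obtain a b where ab: "mod_hom ?G ?M ?N a" "mod_hom ?G ?N ?M b" "\<forall>x\<in>?M. b (a x) = x"
    using summand unfolding direct_summand_def by blast
  have "\<exists>W\<in>set Vs. isomorphic ?G ?Y W" if "indecomposable_decomposition ?G ?N Vs" for Vs
  proof (rule indecomposable_summand_isomorphic[OF ind _ that])
    show "finite_dim ?Y"
      by (rule finite_dim_mono[OF fd(1) YM])
    show "mod_hom ?G ?Y ?N a"
      by (rule mod_hom_subset[OF ab(1) YM]) simp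
    \<comment> \<open>The splitting of M of \<open>\<mu>\<close> followed by the projection onto its
      Young module is a left inverse of the restricted embedding.\<close>
    show "mod_hom ?G ?N ?Y (\<lambda>x. P i (b x))"
      by (rule mod_hom_comp[OF ab(2)]) (use P(1)[OF i(1)] i(2) in simp)
    show "P i (b (a x)) = x" if "x \<in> ?Y" for x
      using ab(3) YP[OF that] by simp
  qed
  then have pos: "0 < length (filter (isomorphic ?G ?Y) Vs)"
    if "indecomposable_decomposition ?G ?N Vs" for Vs
    using that by (simp add: filter_empty_conv)
  have "\<exists>m Vs. indecomposable_decomposition ?G ?N Vs \<and> m = length (filter (isomorphic ?G ?Y) Vs)"
    using indecomposable_decomposition_exists[OF fd(2,3)] by blast
  then have "\<exists>Vs. indecomposable_decomposition ?G ?N Vs \<and>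
      multiplicity_in ?G ?N ?Y = length (filter (isomorphic ?G ?Y) Vs)"
    unfolding multiplicity_in_def by (rule someI_ex)
  then show ?thesis
    unfolding p_kostka_def using pos by metis
qed

section \<open>Summands of Young permutation modules\<close>

lemma tableau_row_Cons:
  "tableau_row (m # \<mu>) (initial_tableau (m # \<mu>)) (Suc i)
    = {m + sum_list (take i \<mu>) <.. m + sum_list (take i \<mu>) + \<mu> ! i}"
proof (intro equalityI subsetI)
  fix x assume x: "x \<in> {m + sum_list (take i \<mu>) <.. m + sum_list (take i \<mu>) + \<mu> ! i}"
  show "x \<in> tableau_row (m # \<mu>) (initial_tableau (m # \<mu>)) (Suc i)"
    unfolding tableau_row_def initial_tableau_def
    \<comment> \<open>The witness is the column number, counted from 0, whereas the entries of the
      row start one past the offset.\<close>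
    using x by (intro CollectI exI[of _ "x - Suc (m + sum_list (take i \<mu>))"]) auto
qed (auto simp: tableau_row_def initial_tableau_def)

text \<open>The rows partition \<open>{1..n}\<close>, so a permutation preserves the first row as soon as it preserves
  the others.\<close>

lemma young_subgroup_Cons:
  assumes n: "m + sum_list \<mu> = n"
  shows "young_subgroup n (m # \<mu>) = {\<sigma>. \<sigma> permutes {1..n} \<and> (\<forall>i<length \<mu>.
    \<forall>x\<in>{m + sum_list (take i \<mu>) <.. m + sum_list (take i \<mu>) + \<mu> ! i}.
      \<sigma> x \<in> {m + sum_list (take i \<mu>) <.. m + sum_list (take i \<mu>) + \<mu> ! i})}"
proof -
  let ?R = "tableau_row (m # \<mu>) (initial_tableau (m # \<mu>))"
  have row: "?R i = {x \<in> {1..n}. fst (cell (m # \<mu>) x) = i}" if "i < Suc (length \<mu>)" for i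
    using tableau_row_initial[of i "m # \<mu>"] that n by simp
  have row0: "?R 0 = {1..n} - (\<Union>i<length \<mu>. ?R (Suc i))"
  proof (intro equalityI subsetI)
    fix x assume x: "x \<in> {1..n} - (\<Union>i<length \<mu>. ?R (Suc i))"
    have "fst (cell (m # \<mu>) x) = 0"
    proof (cases "fst (cell (m # \<mu>) x)")
      case (Suc i)
      then have "i < length \<mu>"
        using x initial_tableau_cell(2)[of x "m # \<mu>"] n by simp
      moreover from this have "x \<in> ?R (Suc i)"
        using x row[of "Suc i"] Suc by simp
      ultimately show ?thesis
        using x by blast
    qed
    then show "x \<in> ?R 0"
      using x row by simp
  qed (use row in auto)
  have rest: "\<sigma> ` ?R 0 = ?R 0"
    if "\<sigma> permutes {1..n}" "\<forall>i<length \<mu>. \<sigma> ` ?R (Suc i) = ?R (Suc i)" for \<sigma>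
    unfolding row0 using that
    by (simp add: image_set_diff[OF permutes_inj[OF that(1)]] permutes_image image_UN)
  have image: "\<sigma> ` ?R (Suc i) = ?R (Suc i) \<longleftrightarrow> (\<forall>x\<in>?R (Suc i). \<sigma> x \<in> ?R (Suc i))"
    if "\<sigma> permutes {1..n}" for \<sigma> i
  proof -
    have "finite (?R (Suc i))"
      by (simp add: tableau_row_Cons)
    then show ?thesis
      using endo_inj_surj[of "?R (Suc i)" \<sigma>] permutes_inj_on[OF that] by blast
  qed
  have "(\<forall>i<length (m # \<mu>). \<sigma> ` ?R i = ?R i) \<longleftrightarrow> (\<forall>i<length \<mu>. \<forall>x\<in>?R (Suc i). \<sigma> x \<in> ?R (Suc i))"
    if "\<sigma> permutes {1..n}" for \<sigma>
  proof -
    have "(\<forall>i<length (m # \<mu>). \<sigma> ` ?R i = ?R i)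
        \<longleftrightarrow> \<sigma> ` ?R 0 = ?R 0 \<and> (\<forall>i<length \<mu>. \<sigma> ` ?R (Suc i) = ?R (Suc i))"
      by (simp only: length_Cons All_less_Suc2)
    also have "\<dots> \<longleftrightarrow> (\<forall>i<length \<mu>. \<sigma> ` ?R (Suc i) = ?R (Suc i))"
      using rest[OF that] by blast
    also have "\<dots> \<longleftrightarrow> (\<forall>i<length \<mu>. \<forall>x\<in>?R (Suc i). \<sigma> x \<in> ?R (Suc i))"
      by (simp only: image[OF that])
    finally show ?thesis .
  qed
  then have "young_subgroup n (m # \<mu>)
      = {\<sigma>. \<sigma> permutes {1..n} \<and> (\<forall>i<length \<mu>. \<forall>x\<in>?R (Suc i). \<sigma> x \<in> ?R (Suc i))}"
    unfolding young_subgroup_def sym_group_carrier by (rule Collect_cong[OF conj_cong[OF refl]])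
  then show ?thesis
    by (simp only: tableau_row_Cons)
qed

section \<open>The Young subgroups for n = m + 3, described by their action on the last
  entries\<close>

lemma young_subgroup_21:
  "young_subgroup (Suc (Suc (Suc m))) [m, 2, Suc 0] = {\<sigma>. \<sigma> permutes {Suc 0..Suc (Suc (Suc m))} \<and> \<sigma> (Suc (Suc (Suc m))) = Suc (Suc (Suc m)) \<and>
    \<sigma> (Suc m) \<in> {Suc m, Suc (Suc m)} \<and> \<sigma> (Suc (Suc m)) \<in> {Suc m, Suc (Suc m)}}"
proof -
  have "{m<..Suc (Suc m)} = {Suc m, Suc (Suc m)}" "{Suc (Suc m)<..Suc (Suc (Suc m))} = {Suc (Suc (Suc m))}"
    by auto
  then show ?thesis
    by (subst young_subgroup_Cons) (simp_all add: All_less_Suc conj_ac del: greaterThanAtMost_iff)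
qed

lemma young_subgroup_3:
  "young_subgroup (Suc (Suc (Suc m))) [m, 3] = {\<sigma>. \<sigma> permutes {Suc 0..Suc (Suc (Suc m))} \<and>
    (\<forall>x\<in>{Suc m, Suc (Suc m), Suc (Suc (Suc m))}. \<sigma> x \<in> {Suc m, Suc (Suc m), Suc (Suc (Suc m))})}"
proof -
  have "{m<..m + 3} = {Suc m, Suc (Suc m), Suc (Suc (Suc m))}"
    by auto
  then show ?thesis
    by (subst young_subgroup_Cons) (simp_all del: greaterThanAtMost_iff)
qed

lemma young_subgroup_2:
  "young_subgroup (Suc (Suc (Suc m))) [Suc m, 2] = {\<sigma>. \<sigma> permutes {Suc 0..Suc (Suc (Suc m))} \<and>
    (\<forall>x\<in>{Suc (Suc m), Suc (Suc (Suc m))}. \<sigma> x \<in> {Suc (Suc m), Suc (Suc (Suc m))})}"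
proof -
  have "{Suc m<..Suc (Suc (Suc m))} = {Suc (Suc m), Suc (Suc (Suc m))}"
    by auto
  then show ?thesis
    by (subst young_subgroup_Cons) (simp_all del: greaterThanAtMost_iff)
qed

lemma young_subgroup_11:
  "young_subgroup (Suc (Suc (Suc m))) [Suc m, Suc 0, Suc 0] = {\<sigma>. \<sigma> permutes {Suc 0..Suc (Suc (Suc m))} \<and>
    \<sigma> (Suc (Suc m)) = Suc (Suc m) \<and> \<sigma> (Suc (Suc (Suc m))) = Suc (Suc (Suc m))}"
proof -
  have "{Suc m<..Suc (Suc m)} = {Suc (Suc m)}" "{Suc (Suc m)<..Suc (Suc (Suc m))} = {Suc (Suc (Suc m))}"
    by auto
  then show ?thesis
    by (subst young_subgroup_Cons) (simp_all add: All_less_Suc conj_ac del: greaterThanAtMost_iff)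
qed

lemma young_subgroup_1:
  "young_subgroup (Suc (Suc (Suc m))) [Suc (Suc m), Suc 0] = {\<sigma>. \<sigma> permutes {Suc 0..Suc (Suc (Suc m))} \<and> \<sigma> (Suc (Suc (Suc m))) = Suc (Suc (Suc m))}"
proof -
  have "{Suc (Suc m)<..Suc (Suc (Suc m))} = {Suc (Suc (Suc m))}"
    by auto
  then show ?thesis
    by (subst young_subgroup_Cons) (simp_all del: greaterThanAtMost_iff)
qed

lemma permutes_neq:
  "\<sigma> permutes A \<Longrightarrow> \<sigma> x = y \<Longrightarrow> z \<noteq> x \<Longrightarrow> \<sigma> z \<noteq> y"
  by (metis permutes_inj injD)

lemma direct_summand_3_21:
  assumes "(3 :: 'k::field) \<noteq> 0"
  shows "direct_summand (sym_group (Suc (Suc (Suc m)))) (young_permutation_module (Suc (Suc (Suc m))) [m, 3] :: (_ \<Rightarrow> 'k) set)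
    (young_permutation_module (Suc (Suc (Suc m))) [m, 2, Suc 0])"
  unfolding young_permutation_module_def
proof (rule direct_summand_index[where a = "Suc (Suc (Suc m))" and X = "{Suc m, Suc (Suc m), Suc (Suc (Suc m))}"])
  let ?H = "young_subgroup (Suc (Suc (Suc m))) [m, 3]" and ?L = "young_subgroup (Suc (Suc (Suc m))) [m, 2, Suc 0]"
  show "subgroup ?H (sym_group (Suc (Suc (Suc m))))" "subgroup ?L (sym_group (Suc (Suc (Suc m))))"
    by (simp_all add: subgroup_young)
  show "h (Suc (Suc (Suc m))) \<in> {Suc m, Suc (Suc m), Suc (Suc (Suc m))}" if "h \<in> ?H" for h
    using that by (simp add: young_subgroup_3)
  show "transpose c (Suc (Suc (Suc m))) \<in> ?H" if "c \<in> {Suc m, Suc (Suc m), Suc (Suc (Suc m))}" for c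
    using that permutes_swap_id[of c "{Suc 0..Suc (Suc (Suc m))}" "Suc (Suc (Suc m))"]
    by (auto simp: young_subgroup_3 transpose_def)
  show "h \<in> ?L \<longleftrightarrow> h \<in> ?H \<and> h (Suc (Suc (Suc m))) = Suc (Suc (Suc m))" for h
    \<comment> \<open>Once the last entry is fixed, injectivity keeps the other two of its row away
      from it.\<close>
    using permutes_neq[of h "{Suc 0..Suc (Suc (Suc m))}" "Suc (Suc (Suc m))" "Suc (Suc (Suc m))" "Suc m"]
      permutes_neq[of h "{Suc 0..Suc (Suc (Suc m))}" "Suc (Suc (Suc m))" "Suc (Suc (Suc m))" "Suc (Suc m)"]
    by (auto simp: young_subgroup_3 young_subgroup_21)
  show "of_nat (card {Suc m, Suc (Suc m), Suc (Suc (Suc m))}) \<noteq> (0 :: 'k)"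
    using assms by simp
qed

lemma direct_summand_2_11:
  assumes "(2 :: 'k::field) \<noteq> 0"
  shows "direct_summand (sym_group (Suc (Suc (Suc m)))) (young_permutation_module (Suc (Suc (Suc m))) [Suc m, 2] :: (_ \<Rightarrow> 'k) set)
    (young_permutation_module (Suc (Suc (Suc m))) [Suc m, Suc 0, Suc 0])"
  unfolding young_permutation_module_def
proof (rule direct_summand_index[where a = "Suc (Suc (Suc m))" and X = "{Suc (Suc m), Suc (Suc (Suc m))}"])
  let ?H = "young_subgroup (Suc (Suc (Suc m))) [Suc m, 2]" and ?L = "young_subgroup (Suc (Suc (Suc m))) [Suc m, Suc 0, Suc 0]"
  show "subgroup ?H (sym_group (Suc (Suc (Suc m))))" "subgroup ?L (sym_group (Suc (Suc (Suc m))))"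
    by (simp_all add: subgroup_young)
  show "h (Suc (Suc (Suc m))) \<in> {Suc (Suc m), Suc (Suc (Suc m))}" if "h \<in> ?H" for h
    using that by (simp add: young_subgroup_2)
  show "transpose c (Suc (Suc (Suc m))) \<in> ?H" if "c \<in> {Suc (Suc m), Suc (Suc (Suc m))}" for c
    using that permutes_swap_id[of c "{Suc 0..Suc (Suc (Suc m))}" "Suc (Suc (Suc m))"]
    by (auto simp: young_subgroup_2 transpose_def)
  show "h \<in> ?L \<longleftrightarrow> h \<in> ?H \<and> h (Suc (Suc (Suc m))) = Suc (Suc (Suc m))" for h
    using permutes_neq[of h "{Suc 0..Suc (Suc (Suc m))}" "Suc (Suc (Suc m))" "Suc (Suc (Suc m))" "Suc (Suc m)"]
    by (auto simp: young_subgroup_2 young_subgroup_11)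
  show "of_nat (card {Suc (Suc m), Suc (Suc (Suc m))}) \<noteq> (0 :: 'k)"
    using assms by simp
qed

text \<open>Write (a, b) for the entries in the last two rows. The map to M of (m + 2, 1) forgets a,
  so the first fact describes the composite T as a sum over all possible a, including the original
  one at \<open>c\<close> = m + 2. The second is the composite in the other order, the index m + 2,
  and yields the quadratic relation for T.\<close>

lemma hecke_11_1:
  fixes f :: "_ \<Rightarrow> 'k::field"
  defines "H m \<equiv> young_subgroup (Suc (Suc (Suc m))) [Suc m, Suc 0, Suc 0]" and "K m \<equiv> young_subgroup (Suc (Suc (Suc m))) [Suc (Suc m), Suc 0]"
  shows "g permutes {1..Suc (Suc (Suc m))} \<Longrightarrow> hecke (Suc (Suc (Suc m))) (K m) (H m) (hecke (Suc (Suc (Suc m))) (H m) (K m) f)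
      (g <#\<^bsub>sym_group (Suc (Suc (Suc m)))\<^esub> H m)
    = (\<Sum>c\<in>{Suc 0..Suc (Suc m)}. f ((g \<circ> transpose c (Suc (Suc m))) <#\<^bsub>sym_group (Suc (Suc (Suc m)))\<^esub> H m))"
    and "f' \<in> permutation_module (sym_group (Suc (Suc (Suc m)))) (K m) \<Longrightarrow>
      hecke (Suc (Suc (Suc m))) (H m) (K m) (hecke (Suc (Suc (Suc m))) (K m) (H m) f') = scale_fun (of_nat (Suc (Suc m)) :: 'k) f'"
proof -
  have sub: "subgroup (H m) (sym_group (Suc (Suc (Suc m))))" "subgroup (K m) (sym_group (Suc (Suc (Suc m))))"
    by (simp_all add: H_def K_def subgroup_young)
  have orbit: "h (Suc (Suc m)) \<in> {Suc 0..Suc (Suc m)}" if "h \<in> K m" for h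
  proof -
    have h: "h permutes {Suc 0..Suc (Suc (Suc m))}" "h (Suc (Suc (Suc m))) = Suc (Suc (Suc m))"
      using that by (simp_all add: K_def young_subgroup_1)
    then have "h (Suc (Suc m)) \<noteq> Suc (Suc (Suc m))" "h (Suc (Suc m)) \<in> {Suc 0..Suc (Suc (Suc m))}"
      using permutes_neq[OF h, of "Suc (Suc m)"] permutes_in_image[OF h(1), of "Suc (Suc m)"] by auto
    then show ?thesis
      by auto
  qed
  have transp: "transpose c (Suc (Suc m)) \<in> K m" if "c \<in> {Suc 0..Suc (Suc m)}" for c
    using that permutes_swap_id[of c "{Suc 0..Suc (Suc (Suc m))}" "Suc (Suc m)"]
    by (auto simp: K_def young_subgroup_1 transpose_def)
  have stab: "h \<in> H m \<longleftrightarrow> h \<in> K m \<and> h (Suc (Suc m)) = Suc (Suc m)" for h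
    by (auto simp: H_def K_def young_subgroup_1 young_subgroup_11)
  {
    assume g: "g permutes {1..Suc (Suc (Suc m))}"
    have "hecke (Suc (Suc (Suc m))) (K m) (H m) (hecke (Suc (Suc (Suc m))) (H m) (K m) f) (g <#\<^bsub>sym_group (Suc (Suc (Suc m)))\<^esub> H m)
        = hecke (Suc (Suc (Suc m))) (H m) (K m) f (g <#\<^bsub>sym_group (Suc (Suc (Suc m)))\<^esub> K m)"
      by (rule hecke_restrict[OF sub(2,1), of "Suc (Suc m)"]) (use stab g in auto)
    also have "\<dots> = (\<Sum>c\<in>{Suc 0..Suc (Suc m)}. f ((g \<circ> transpose c (Suc (Suc m))) <#\<^bsub>sym_group (Suc (Suc (Suc m)))\<^esub> H m))"
      by (rule hecke_transpose[OF sub]) (use orbit transp stab g in auto)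
    finally show "hecke (Suc (Suc (Suc m))) (K m) (H m) (hecke (Suc (Suc (Suc m))) (H m) (K m) f)
        (g <#\<^bsub>sym_group (Suc (Suc (Suc m)))\<^esub> H m)
      = (\<Sum>c\<in>{Suc 0..Suc (Suc m)}. f ((g \<circ> transpose c (Suc (Suc m))) <#\<^bsub>sym_group (Suc (Suc (Suc m)))\<^esub> H m))" .
  }
  {
    assume "f' \<in> permutation_module (sym_group (Suc (Suc (Suc m)))) (K m)"
    then show "hecke (Suc (Suc (Suc m))) (H m) (K m) (hecke (Suc (Suc (Suc m))) (K m) (H m) f')
        = scale_fun (of_nat (Suc (Suc m)) :: 'k) f'"
      using hecke_index[OF sub(2,1), of "Suc (Suc m)" "{Suc 0..Suc (Suc m)}" f'] orbit transp stab by simp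
  }
qed

text \<open>In terms of the ordered pair \<open>(a, b)\<close> of entries in the last two rows, the composite sends
  \<open>(a, b)\<close> to the sum over \<open>c \<notin> {a, b}\<close> of \<open>(a, b) + (c, b)\<close>.\<close>

lemma hecke_11_21:
  fixes f :: "_ \<Rightarrow> 'k::field"
  defines "H m \<equiv> young_subgroup (Suc (Suc (Suc m))) [Suc m, Suc 0, Suc 0]" and "K m \<equiv> young_subgroup (Suc (Suc (Suc m))) [Suc (Suc m), Suc 0]"
    and "L m \<equiv> young_subgroup (Suc (Suc (Suc m))) [m, 2, Suc 0]"
  assumes f: "f \<in> permutation_module (sym_group (Suc (Suc (Suc m)))) (H m)"
  shows "hecke (Suc (Suc (Suc m))) (L m) (H m) (hecke (Suc (Suc (Suc m))) (H m) (L m) f)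
    = scale_fun (of_nat m) f + hecke (Suc (Suc (Suc m))) (K m) (H m) (hecke (Suc (Suc (Suc m))) (H m) (K m) f)"
proof (rule permutation_module_eqI)
  let ?G = "sym_group (Suc (Suc (Suc m)))"
  have sub: "subgroup (H m) ?G" "subgroup (L m) ?G"
    by (simp_all add: H_def L_def subgroup_young)
  note M = submodule_permutation_module mod_hom_hecke
  note hM = mod_hom_in[OF M(2)]
  show "hecke (Suc (Suc (Suc m))) (L m) (H m) (hecke (Suc (Suc (Suc m))) (H m) (L m) f) \<in> permutation_module ?G (H m)"
    by (rule hM[OF hM[OF f]])
  show "scale_fun (of_nat m) f + hecke (Suc (Suc (Suc m))) (K m) (H m) (hecke (Suc (Suc (Suc m))) (H m) (K m) f)
      \<in> permutation_module ?G (H m)"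
    by (rule submodule_add[OF M(1) submodule_scale[OF M(1) f] hM[OF hM[OF f]]])
  fix g assume g: "g permutes {1..Suc (Suc (Suc m))}"
  define F where "F k = f (k <#\<^bsub>?G\<^esub> H m)" for k
  let ?\<tau> = "\<lambda>c. transpose c (Suc m)" and ?s = "transpose (Suc m) (Suc (Suc m))"
  have \<tau>: "?\<tau> c \<in> H m" "g \<circ> ?\<tau> c permutes {1..Suc (Suc (Suc m))}" if "c \<in> {Suc 0..Suc m}" for c
  proof -
    have "?\<tau> c permutes {Suc 0..Suc (Suc (Suc m))}"
      using that by (intro permutes_swap_id) auto
    then show "?\<tau> c \<in> H m" "g \<circ> ?\<tau> c permutes {1..Suc (Suc (Suc m))}"
      using that g by (auto simp: H_def young_subgroup_11 transpose_def intro: permutes_compose)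
  qed
  \<comment> \<open>The m + 1 terms are the choices of the entry \<open>c\<close> of the long row
    that joins a in a row of length 2.\<close>
  have 1: "hecke (Suc (Suc (Suc m))) (L m) (H m) f' (g <#\<^bsub>?G\<^esub> H m)
      = (\<Sum>c\<in>{Suc 0..Suc m}. f' ((g \<circ> ?\<tau> c) <#\<^bsub>?G\<^esub> L m))" for f' :: "_ \<Rightarrow> 'k"
  proof (rule hecke_transpose[OF sub(2,1) _ \<tau>(1) _ g])
    fix h assume "h \<in> H m"
    then have h: "h permutes {Suc 0..Suc (Suc (Suc m))}" "h (Suc (Suc m)) = Suc (Suc m)"
        "h (Suc (Suc (Suc m))) = Suc (Suc (Suc m))"
      by (simp_all add: H_def young_subgroup_11)
    then have ne: "h (Suc m) \<noteq> Suc (Suc m)" "h (Suc m) \<noteq> Suc (Suc (Suc m))"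
      using permutes_neq[OF h(1,2), of "Suc m"] permutes_neq[OF h(1,3), of "Suc m"] by simp_all
    moreover have "h (Suc m) \<in> {Suc 0..Suc (Suc (Suc m))}"
      using permutes_in_image[OF h(1), of "Suc m"] by auto
    ultimately show "h (Suc m) \<in> {Suc 0..Suc m}"
      by auto
    show "h \<in> L m \<longleftrightarrow> h (Suc m) = Suc m"
      using h ne by (auto simp: L_def young_subgroup_21)
  qed
  \<comment> \<open>The two terms are the two orderings of the row of length 2.\<close>
  have 2: "hecke (Suc (Suc (Suc m))) (H m) (L m) f (k <#\<^bsub>?G\<^esub> L m) = F (k \<circ> ?s) + F k"
    if "k permutes {1..Suc (Suc (Suc m))}" for k
  proof -
    have "hecke (Suc (Suc (Suc m))) (H m) (L m) f (k <#\<^bsub>?G\<^esub> L m)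
        = (\<Sum>c\<in>{Suc m, Suc (Suc m)}. f ((k \<circ> transpose c (Suc (Suc m))) <#\<^bsub>?G\<^esub> H m))"
    proof (rule hecke_transpose[OF sub _ _ _ that])
      show "l (Suc (Suc m)) \<in> {Suc m, Suc (Suc m)}" if "l \<in> L m" for l
        using that by (simp add: L_def young_subgroup_21)
      show "transpose c (Suc (Suc m)) \<in> L m" if "c \<in> {Suc m, Suc (Suc m)}" for c
        using that permutes_swap_id[of c "{Suc 0..Suc (Suc (Suc m))}" "Suc (Suc m)"]
        by (auto simp: L_def young_subgroup_21 transpose_def)
      show "l \<in> H m \<longleftrightarrow> l (Suc (Suc m)) = Suc (Suc m)" if "l \<in> L m" for l
        using that by (auto simp: L_def H_def young_subgroup_21 young_subgroup_11)
    qed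
    then show ?thesis
      by (simp add: F_def)
  qed
  have inv: "F (k \<circ> h) = F k" if "h \<in> H m" for k h
    unfolding F_def by (simp only: lcoset_comp_member[OF sub(1) that])
  have "F (g \<circ> ?\<tau> c \<circ> ?s) = F (g \<circ> transpose c (Suc (Suc m)))" if "c \<in> {Suc 0..Suc m}" for c
  proof -
    \<comment> \<open>The trailing transposition lies in \<open>H m\<close>, so it can be appended
      for free; it turns the product into a conjugate, a single transposition.\<close>
    have "?\<tau> c \<circ> ?s \<circ> ?\<tau> c = transpose c (Suc (Suc m))"
      using that by (auto simp: fun_eq_iff transpose_def)
    then have "g \<circ> ?\<tau> c \<circ> ?s \<circ> ?\<tau> c = g \<circ> transpose c (Suc (Suc m))"
      by (simp add: comp_assoc)
    then show ?thesis
      using inv[OF \<tau>(1)[OF that], of "g \<circ> ?\<tau> c \<circ> ?s"] by simp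
  qed
  then have "hecke (Suc (Suc (Suc m))) (L m) (H m) (hecke (Suc (Suc (Suc m))) (H m) (L m) f) (g <#\<^bsub>?G\<^esub> H m)
      = (\<Sum>c\<in>{Suc 0..Suc m}. F (g \<circ> transpose c (Suc (Suc m))) + F g)"
    unfolding 1 by (intro sum.cong refl) (simp add: 2[OF \<tau>(2)] inv[OF \<tau>(1)])
  \<comment> \<open>Of the m + 1 copies of \<open>F g\<close>, m form the scalar part; the last is
    the missing term \<open>c\<close> = m + 2 of T, where the transposition is the identity.\<close>
  also have "\<dots> = of_nat m * F g + ((\<Sum>c\<in>{Suc 0..Suc m}. F (g \<circ> transpose c (Suc (Suc m)))) + F g)"
    by (simp add: sum.distrib algebra_simps)
  also have "(\<Sum>c\<in>{Suc 0..Suc m}. F (g \<circ> transpose c (Suc (Suc m)))) + F g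
      = (\<Sum>c\<in>{Suc 0..Suc (Suc m)}. F (g \<circ> transpose c (Suc (Suc m))))"
    by (simp add: numeral_2_eq_2)
  also have "\<dots> = hecke (Suc (Suc (Suc m))) (K m) (H m) (hecke (Suc (Suc (Suc m))) (H m) (K m) f) (g <#\<^bsub>?G\<^esub> H m)"
    unfolding F_def H_def K_def by (rule hecke_11_1(1)[OF g, symmetric])
  finally show "hecke (Suc (Suc (Suc m))) (L m) (H m) (hecke (Suc (Suc (Suc m))) (H m) (L m) f) (g <#\<^bsub>?G\<^esub> H m)
      = (scale_fun (of_nat m) f + hecke (Suc (Suc (Suc m))) (K m) (H m) (hecke (Suc (Suc (Suc m))) (H m) (K m) f))
        (g <#\<^bsub>?G\<^esub> H m)"
    by (simp add: plus_fun_apply scale_fun_def F_def)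
qed

text \<open>Let \<open>T\<close> be the composite of the canonical maps from \<open>M\<close> of \<open>(m + 1, 1, 1)\<close> to \<open>M\<close> of
  \<open>(m + 2, 1)\<close> and back. Since \<open>T\<^sup>2 = (m + 2) T\<close>, the inverse of \<open>m + T\<close> is
  \<open>(1 - T / (2 m + 2)) / m\<close>.\<close>

lemma direct_summand_11_21:
  assumes m: "of_nat m \<noteq> (0 :: 'k::field)" and w: "of_nat (2 * m + 2) \<noteq> (0 :: 'k)"
  shows "direct_summand (sym_group (Suc (Suc (Suc m))))
    (young_permutation_module (Suc (Suc (Suc m))) [Suc m, Suc 0, Suc 0] :: (_ \<Rightarrow> 'k) set)
    (young_permutation_module (Suc (Suc (Suc m))) [m, 2, Suc 0])"
  unfolding young_permutation_module_def direct_summand_def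
proof (intro exI conjI ballI)
  let ?G = "sym_group (Suc (Suc (Suc m)))"
  let ?H = "young_subgroup (Suc (Suc (Suc m))) [Suc m, Suc 0, Suc 0]" and ?K = "young_subgroup (Suc (Suc (Suc m))) [Suc (Suc m), Suc 0]"
    and ?L = "young_subgroup (Suc (Suc (Suc m))) [m, 2, Suc 0]"
  let ?M = "permutation_module ?G ?H :: (_ \<Rightarrow> 'k) set"
  note sub = submodule_permutation_module and hom = mod_hom_hecke
  define T :: "(_ \<Rightarrow> 'k) \<Rightarrow> _" where "T = (\<lambda>x. hecke (Suc (Suc (Suc m))) ?K ?H (hecke (Suc (Suc (Suc m))) ?H ?K x))"
  define r :: "(_ \<Rightarrow> 'k) \<Rightarrow> _" where "r = (\<lambda>x. x + scale_fun (- 1 / of_nat (2 * m + 2)) (T x))"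
  have T: "mod_hom ?G ?M ?M T"
    unfolding T_def by (rule mod_hom_comp[OF hom hom])
  have r: "mod_hom ?G ?M ?M r"
    unfolding r_def by (rule mod_hom_plus[OF mod_hom_id[OF subset_refl] mod_hom_scaled[OF T sub] sub])
  show "mod_hom ?G ?M (permutation_module ?G ?L) (hecke (Suc (Suc (Suc m))) ?H ?L)"
    by (rule hom)
  show "mod_hom ?G (permutation_module ?G ?L) ?M
      (\<lambda>y. scale_fun (1 / of_nat m) (r (hecke (Suc (Suc (Suc m))) ?L ?H y)))"
    by (rule mod_hom_scaled[OF mod_hom_comp[OF hom r] sub])
  fix x assume x: "x \<in> ?M"
  have Tx: "T x \<in> ?M"
    by (rule mod_hom_in[OF T x])
  have TT: "T (T x) = scale_fun (of_nat (Suc (Suc m))) (T x)"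
    unfolding T_def hecke_11_1(2)[OF mod_hom_in[OF hom x]]
    by (rule mod_hom_scale[OF hom mod_hom_in[OF hom x]])
  let ?w = "of_nat (2 * m + 2) :: 'k"
  \<comment> \<open>The quadratic relation collapses this to 2 m + 2 times \<open>T x\<close>, and
    the coefficient in \<open>r\<close> then removes exactly the summand \<open>T x\<close>.\<close>
  have "T (scale_fun (of_nat m) x + T x) = scale_fun (of_nat m + of_nat (Suc (Suc m))) (T x)"
    unfolding mod_hom_add[OF T submodule_scale[OF sub x] Tx] mod_hom_scale[OF T x] TT
    by (rule fun_space.scale_left_distrib[symmetric])
  moreover have "of_nat m + of_nat (Suc (Suc m)) = ?w"
    by simp
  ultimately have "r (scale_fun (of_nat m) x + T x)
      = scale_fun (of_nat m) x + T x + scale_fun (- 1 / ?w) (scale_fun ?w (T x))"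
    by (simp only: r_def)
  also have "scale_fun (- 1 / ?w) (scale_fun ?w (T x)) = - T x"
    using w by (simp only: fun_space.scale_scale nonzero_eq_divide_eq times_divide_eq_left
        nonzero_mult_div_cancel_right fun_space.scale_minus_left fun_space.scale_one not_False_eq_True)
  finally have "r (scale_fun (of_nat m) x + T x) = scale_fun (of_nat m) x"
    by simp
  moreover have "hecke (Suc (Suc (Suc m))) ?L ?H (hecke (Suc (Suc (Suc m))) ?H ?L x) = scale_fun (of_nat m) x + T x"
    unfolding T_def by (rule hecke_11_21[OF x])
  ultimately show "scale_fun (1 / of_nat m) (r (hecke (Suc (Suc (Suc m))) ?L ?H (hecke (Suc (Suc (Suc m))) ?H ?L x))) = x"
    using m by simp
qed

theorem corollary4p3:
  fixes p n :: nat
  assumes "prime p" and "p > 3" and "CHAR('k::field) = p"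
    and "n > 0" and "p dvd n"
  shows "(n \<ge> 6 \<longrightarrow> p_kostka TYPE('k) n [n - 3, 2, 1] [n - 3, 3] > 0) \<and>
    p_kostka TYPE('k) n [n - 3, 2, 1] [n - 2, 1, 1] > 0 \<and>
    (p = 5 \<longrightarrow> p_kostka TYPE('k) n [n - 3, 2, 1] [n - 2, 2] > 0)"
proof -
  \<comment> \<open>With 4 excluded, p is at least 5. This makes 2, 3 and 4 invertible at once and
    gives n at least 5, hence m at least 2.\<close>
  have "p \<noteq> 4"
    using \<open>prime p\<close> by auto
  then have p5: "p \<ge> 5"
    using \<open>p > 3\<close> by simp
  then have n5: "n \<ge> 5"
    using dvd_imp_le[OF \<open>p dvd n\<close> \<open>n > 0\<close>] by simp
  define m where "m = n - 3"
  have n: "n = Suc (Suc (Suc m))"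
    using n5 by (simp add: m_def)
  have char: "of_nat k = (0 :: 'k) \<longleftrightarrow> p dvd k" for k
    using of_nat_eq_0_iff_char_dvd[where 'a = 'k] assms(3) by simp
  have small: "of_nat k \<noteq> (0 :: 'k)" if "0 < k" "k < 5" for k
    using char[of k] that p5 dvd_imp_le[of p k] by auto
  have two: "(2 :: 'k) \<noteq> 0" and three: "(3 :: 'k) \<noteq> 0"
    using small[of 2] small[of 3] by simp_all
  have n0: "of_nat m + 3 = (0 :: 'k)"
    using char[of n] \<open>p dvd n\<close> by (simp add: n add.commute)
  then have m: "of_nat m \<noteq> (0 :: 'k)"
    using three by auto
  \<comment> \<open>That is 2 n - 4, and n is zero in the field.\<close>
  have "of_nat (2 * m + 2) = 2 * (of_nat m + 3) - (of_nat 4 :: 'k)"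
    by (simp add: algebra_simps)
  also have "\<dots> = - of_nat 4"
    by (simp only: n0 mult_zero_right diff_0)
  finally have w: "of_nat (2 * m + 2) \<noteq> (0 :: 'k)"
    using small[of 4] by (simp only: neg_equal_0_iff_equal) simp
  note S = direct_summand_11_21[OF m w]
  \<comment> \<open>The bound on n says that m is at least 3, so that the list \<open>[m, 3]\<close>
    is weakly decreasing, as the existence of its Young module requires.\<close>
  have "p_kostka TYPE('k) n [m, 2, 1] [m, 3] > 0" if "n \<ge> 6"
    by (rule p_kostka_pos[OF _ _ two])
      (use direct_summand_3_21[OF three, of m] that n in auto)
  moreover have "p_kostka TYPE('k) n [m, 2, 1] [Suc m, 1, 1] > 0"
    by (rule p_kostka_pos[OF _ _ two]) (use S n in auto)
  moreover have "p_kostka TYPE('k) n [m, 2, 1] [Suc m, 2] > 0"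
    by (rule p_kostka_pos[OF _ _ two])
      (use direct_summand_trans[OF direct_summand_2_11[OF two] S] n5 n in auto)
  moreover have "n - 3 = m" "n - 2 = Suc m"
    using n by simp_all
  ultimately show ?thesis
    by simp
qed

end
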